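(* Let $A$ be an alphabet. The planar arborification map $\mathfrak a_\ll:\mathcal H^A_{\mathrm{MKW}}\to\mathcal H^A_{\sqcup\!\sqcup}$ is a surjective Hopf algebra morphism; it is a combinatorial morphism when $A$ is finite. Moreover $\mathfrak a_\ll\circ\Omega=\mathfrak a$, where $\Omega$ is the symmetrization map and $\mathfrak a$ the simple arborification map on decorated non-planar forests.
   Context: $A$-decorated planar forest: finite left-to-right ordered sequence of planar rooted trees with a decoration map $\varphi:V\to A$; $|\tau|$ = number of vertices; $\mathbf 1$ the empty forest. On vertices, $v<w$ iff $v\neq w$ and $v$ is on the path from a root to $w$; $\ll$ is the transitive closure of $R$: $vRw$ iff $v<w$, or $v,w$ are children of a common vertex with $v$ to the right of $w$, or $v,w$ are both roots with $v$ to the right of $w$. $\mathcal H^A_{\mathrm{MKW}}$: vector space with basis the $A$-decorated planar forests, graded by number of vertices; product = shuffle product of forests regarded as words whose letters are trees; coproduct $\Delta(\tau)=\sum(\tau|_{V'})^{\sqcup\!\sqcup}\otimes\tau|_{V''}$ over partitions $V(\tau)=V'\sqcup V''$ with $V''$ downward closed for $\ll$, where $\tau|_W$ is the decorated planar forest induced on $W$ (induced edges, inherited planar order) and $(\tau|_{V'})^{\sqcup\!\sqcup}$ is the shuffle product of the forests $\tau|_C$, $C$ ranging over the connected components of the poset $(V',\ll|_{V'})$. $\mathcal H^A_{\sqcup\!\sqcup}$: words on $A$ with shuffle product and deconcatenation coproduct $\Delta(w)=\sum_{uv=w}u\otimes v$. Both are combinatorial Hopf algebras (bases: forests, resp. words);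 a combinatorial morphism is a degree-0 Hopf morphism sending basis elements to nonnegative integer combinations of basis elements. Planar arborification: $\mathfrak a_\ll(\tau)=\sum\varphi(v_1)\cdots\varphi(v_n)$ over enumerations $(v_1,\dots,v_n)$ of $V(\tau)$ with $v_i\ll v_j\Rightarrow i>j$. Simple arborification of a non-planar decorated forest $f$: $\mathfrak a(f)=\sum\varphi(v_1)\cdots\varphi(v_n)$ over enumerations of $V(f)$ with $v_i<v_j\Rightarrow i>j$. A planar structure on a non-planar decorated forest $f$ is a choice of total orders on its set of roots and on each set of children, yielding a decorated planar forest (planar representative); $\mathrm{Sym}(\sigma)$ is the number of planar structures on $f$ yielding $\sigma$; $\Omega(f)=\sum_\sigma\mathrm{Sym}(\sigma)\,\sigma$ over distinct planar representatives $\sigma$ of $f$, extended linearly. *)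

theory Defs
  imports Main "HOL-Library.Poly_Mapping" "HOL-Library.Multiset" "HOL-Library.List_Lexorder"
begin

definition vsingle :: "'b \<Rightarrow> ('b \<Rightarrow>\<^sub>0 'k::field)" where
  "vsingle x = Poly_Mapping.single x 1"

definition smult :: "'k::field \<Rightarrow> ('b \<Rightarrow>\<^sub>0 'k) \<Rightarrow> ('b \<Rightarrow>\<^sub>0 'k)" where
  "smult c u = Poly_Mapping.map ((*) c) u"

definition lin :: "('b \<Rightarrow> ('c \<Rightarrow>\<^sub>0 'k::field)) \<Rightarrow> ('b \<Rightarrow>\<^sub>0 'k) \<Rightarrow> ('c \<Rightarrow>\<^sub>0 'k)" where
  "lin f u = (\<Sum>x\<in>Poly_Mapping.keys u. smult (Poly_Mapping.lookup u x) (f x))"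

definition bilin :: "('b \<Rightarrow> 'b \<Rightarrow> ('c \<Rightarrow>\<^sub>0 'k::field)) \<Rightarrow> ('b \<Rightarrow>\<^sub>0 'k) \<Rightarrow> ('b \<Rightarrow>\<^sub>0 'k) \<Rightarrow> ('c \<Rightarrow>\<^sub>0 'k)" where
  "bilin m u v = (\<Sum>x\<in>Poly_Mapping.keys u. \<Sum>y\<in>Poly_Mapping.keys v. smult (Poly_Mapping.lookup u x * Poly_Mapping.lookup v y) (m x y))"

definition tensor :: "('b \<Rightarrow>\<^sub>0 'k::field) \<Rightarrow> ('c \<Rightarrow>\<^sub>0 'k) \<Rightarrow> (('b \<times> 'c) \<Rightarrow>\<^sub>0 'k)" where
  "tensor u v = (\<Sum>x\<in>Poly_Mapping.keys u. \<Sum>y\<in>Poly_Mapping.keys v. Poly_Mapping.single (x,y) (Poly_Mapping.lookup u x * Poly_Mapping.lookup v y))"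

definition tmap :: "(('b \<Rightarrow>\<^sub>0 'k::field) \<Rightarrow> ('c \<Rightarrow>\<^sub>0 'k)) \<Rightarrow> (('b \<times> 'b) \<Rightarrow>\<^sub>0 'k) \<Rightarrow> (('c \<times> 'c) \<Rightarrow>\<^sub>0 'k)" where
  "tmap f = lin (\<lambda>(x,y). tensor (f (vsingle x)) (f (vsingle y)))"

definition msv :: "'b multiset \<Rightarrow> ('b \<Rightarrow>\<^sub>0 'k::field)" where
  "msv M = (\<Sum>x\<in>set_mset M. Poly_Mapping.single x (of_nat (count M x)))"

fun shuffle_ms :: "'x list \<Rightarrow> 'x list \<Rightarrow> 'x list multiset" where
  "shuffle_ms [] ys = {#ys#}"
| "shuffle_ms xs [] = {#xs#}"
| "shuffle_ms (x # xs) (y # ys) =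
     image_mset ((#) x) (shuffle_ms xs (y # ys)) + image_mset ((#) y) (shuffle_ms (x # xs) ys)"

definition shmult :: "('x list \<Rightarrow>\<^sub>0 'k::field) \<Rightarrow> ('x list \<Rightarrow>\<^sub>0 'k) \<Rightarrow> ('x list \<Rightarrow>\<^sub>0 'k)" where
  "shmult = bilin (\<lambda>x y. msv (shuffle_ms x y))"

definition unitv :: "('x list \<Rightarrow>\<^sub>0 'k::field)" where
  "unitv = vsingle []"

definition counit :: "('x list \<Rightarrow>\<^sub>0 'k::field) \<Rightarrow> 'k" where
  "counit u = Poly_Mapping.lookup u []"

definition deconc :: "'a list \<Rightarrow> (('a list \<times> 'a list) \<Rightarrow>\<^sub>0 'k::field)" where
  "deconc w = (\<Sum>i\<in>{0..length w}. vsingle (take i w, drop i w))"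

definition cop_sh :: "('a list \<Rightarrow>\<^sub>0 'k::field) \<Rightarrow> (('a list \<times> 'a list) \<Rightarrow>\<^sub>0 'k)" where
  "cop_sh = lin deconc"

datatype 'a ptree = Node 'a "'a ptree list"

type_synonym 'a pforest = "'a ptree list"

primrec label :: "'a ptree \<Rightarrow> 'a" where "label (Node a ts) = a"
primrec children :: "'a ptree \<Rightarrow> 'a ptree list" where "children (Node a ts) = ts"

text \<open>Vertices are addressed by paths: [i] is the i-th root, p @ [j] the j-th child of p.\<close>
fun sub :: "'a pforest \<Rightarrow> nat list \<Rightarrow> 'a ptree option" where
  "sub F [] = None"
| "sub F [i] = (if i < length F then Some (F ! i) else None)"
| "sub F (i # j # p) = (if i < length F then sub (children (F ! i)) (j # p) else None)"

definition verts :: "'a pforest \<Rightarrow> nat list set" where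
  "verts F = {p. sub F p \<noteq> None}"

definition dec :: "'a pforest \<Rightarrow> nat list \<Rightarrow> 'a" where
  "dec F v = label (the (sub F v))"

definition anc :: "'a pforest \<Rightarrow> nat list \<Rightarrow> nat list \<Rightarrow> bool" where
  "anc F v w \<longleftrightarrow> v \<in> verts F \<and> w \<in> verts F \<and> (\<exists>u. u \<noteq> [] \<and> w = v @ u)"

definition Rrel :: "'a pforest \<Rightarrow> nat list \<Rightarrow> nat list \<Rightarrow> bool" where
  "Rrel F v w \<longleftrightarrow> anc F v w \<or>
     (v \<in> verts F \<and> w \<in> verts F \<and> (\<exists>p i j. v = p @ [i] \<and> w = p @ [j] \<and> j < i))"

definition ll :: "'a pforest \<Rightarrow> nat list \<Rightarrow> nat list \<Rightarrow> bool" where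
  "ll F = tranclp (Rrel F)"

function ind_tree :: "nat list set \<Rightarrow> nat list \<Rightarrow> 'a ptree \<Rightarrow> 'a ptree" where
  "ind_tree W v (Node a ts) =
     Node a (map (\<lambda>i. ind_tree W (v @ [i]) (ts ! i)) (filter (\<lambda>i. v @ [i] \<in> W) [0..<length ts]))"
  by pat_completeness auto
termination
  by (relation "measure (\<lambda>(W,v,t). size t)")
     (auto simp: less_Suc_eq_le intro!: size_list_estimation'[OF nth_mem])


text \<open>Roots of the induced forest are the vertices of W whose parent is not in W; they are
  ordered by the inherited planar (left-to-right / depth-first) order, i.e. lexicographically
  on paths.\<close>
definition restr :: "'a pforest \<Rightarrow> nat list set \<Rightarrow> 'a pforest" where
  "restr F W = map (\<lambda>v. ind_tree W v (the (sub F v)))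
      (sorted_list_of_set {v \<in> W. v \<in> verts F \<and> butlast v \<notin> W})"

definition comprel :: "'a pforest \<Rightarrow> nat list set \<Rightarrow> nat list \<Rightarrow> nat list \<Rightarrow> bool" where
  "comprel F V1 x y \<longleftrightarrow> x \<in> V1 \<and> y \<in> V1 \<and> (ll F x y \<or> ll F y x)"

definition comps :: "'a pforest \<Rightarrow> nat list set \<Rightarrow> nat list set set" where
  "comps F V1 = {{y \<in> V1. x = y \<or> (comprel F V1)\<^sup>+\<^sup>+ x y} | x. x \<in> V1}"

definition comp_prod :: "'a pforest \<Rightarrow> nat list set \<Rightarrow> ('a pforest \<Rightarrow>\<^sub>0 'k::field)" where
  "comp_prod F V1 = foldr shmult
      (map (\<lambda>C. vsingle (restr F C)) (SOME cs. distinct cs \<and> set cs = comps F V1)) unitv"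

definition downclosed :: "'a pforest \<Rightarrow> nat list set \<Rightarrow> bool" where
  "downclosed F V2 \<longleftrightarrow> V2 \<subseteq> verts F \<and> (\<forall>v w. ll F v w \<and> w \<in> V2 \<longrightarrow> v \<in> V2)"

definition mkw_delta :: "'a pforest \<Rightarrow> (('a pforest \<times> 'a pforest) \<Rightarrow>\<^sub>0 'k::field)" where
  "mkw_delta F = (\<Sum>V2\<in>{V2. downclosed F V2}.
      tensor (comp_prod F (verts F - V2)) (vsingle (restr F V2)))"

definition cop_mkw :: "('a pforest \<Rightarrow>\<^sub>0 'k::field) \<Rightarrow> (('a pforest \<times> 'a pforest) \<Rightarrow>\<^sub>0 'k)" where
  "cop_mkw = lin mkw_delta"

definition arb_ll_basis :: "'a pforest \<Rightarrow> ('a list \<Rightarrow>\<^sub>0 'k::field)" where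
  "arb_ll_basis F = (\<Sum>vs\<in>{vs. distinct vs \<and> set vs = verts F \<and>
        (\<forall>i j. i < length vs \<and> j < length vs \<and> ll F (vs ! i) (vs ! j) \<longrightarrow> i > j)}.
      vsingle (map (dec F) vs))"

definition arb_ll :: "('a pforest \<Rightarrow>\<^sub>0 'k::field) \<Rightarrow> ('a list \<Rightarrow>\<^sub>0 'k)" where
  "arb_ll = lin arb_ll_basis"

text \<open>Both Hopf algebras have basis the lists over some type (forests = lists of trees,
  words = lists of letters), shuffle product, unit the empty list and counit the coefficient
  of the empty list. A Hopf algebra morphism is a linear map compatible with unit, product,
  counit and coproduct (compatibility with antipodes is then automatic).\<close>
definition hopf_morphism ::
  "(('x list \<Rightarrow>\<^sub>0 'k::field) \<Rightarrow> ('y list \<Rightarrow>\<^sub>0 'k))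
   \<Rightarrow> (('x list \<Rightarrow>\<^sub>0 'k) \<Rightarrow> (('x list \<times> 'x list) \<Rightarrow>\<^sub>0 'k))
   \<Rightarrow> (('y list \<Rightarrow>\<^sub>0 'k) \<Rightarrow> (('y list \<times> 'y list) \<Rightarrow>\<^sub>0 'k)) \<Rightarrow> bool" where
  "hopf_morphism f cop1 cop2 \<longleftrightarrow>
     (\<forall>u v. f (u + v) = f u + f v) \<and> (\<forall>c u. f (smult c u) = smult c (f u)) \<and>
     f unitv = unitv \<and> (\<forall>u v. f (shmult u v) = shmult (f u) (f v)) \<and>
     (\<forall>u. counit (f u) = counit u) \<and> (\<forall>u. cop2 (f u) = tmap f (cop1 u))"

definition nverts :: "'a pforest \<Rightarrow> nat" where
  "nverts F = card (verts F)"

definition combinatorial_morphism ::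
  "(('a pforest \<Rightarrow>\<^sub>0 'k::field) \<Rightarrow> ('a list \<Rightarrow>\<^sub>0 'k)) \<Rightarrow> bool" where
  "combinatorial_morphism f \<longleftrightarrow> hopf_morphism f cop_mkw cop_sh \<and>
     (\<forall>F. \<forall>w \<in> Poly_Mapping.keys (f (vsingle F)). length w = nverts F) \<and>
     (\<forall>F w. \<exists>n::nat. Poly_Mapping.lookup (f (vsingle F)) w = of_nat n)"

text \<open>A non-planar forest: finite vertex set V with a parent map (None = root), acyclic.\<close>
definition child_rel :: "'v set \<Rightarrow> ('v \<Rightarrow> 'v option) \<Rightarrow> ('v \<times> 'v) set" where
  "child_rel V par = {(v, u). v \<in> V \<and> par v = Some u}"

definition nforest :: "'v set \<Rightarrow> ('v \<Rightarrow> 'v option) \<Rightarrow> bool" where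
  "nforest V par \<longleftrightarrow> finite V \<and> (\<forall>v\<in>V. \<forall>u. par v = Some u \<longrightarrow> u \<in> V) \<and>
     acyclic (child_rel V par)"

text \<open>v < w iff v is a proper ancestor of w, i.e. (w, v) in the transitive closure.\<close>
definition simple_arb :: "'v set \<Rightarrow> ('v \<Rightarrow> 'v option) \<Rightarrow> ('v \<Rightarrow> 'a) \<Rightarrow> ('a list \<Rightarrow>\<^sub>0 'k::field)" where
  "simple_arb V par phi = (\<Sum>vs\<in>{vs. distinct vs \<and> set vs = V \<and>
        (\<forall>i j. i < length vs \<and> j < length vs \<and> (vs ! j, vs ! i) \<in> (child_rel V par)\<^sup>+ \<longrightarrow> i > j)}.
      vsingle (map phi vs))"

text \<open>A planar structure: ord None lists the roots, ord (Some u) lists the children of u,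
  each in a chosen total order (normalized to [] outside the relevant arguments).\<close>
definition planar_structure :: "'v set \<Rightarrow> ('v \<Rightarrow> 'v option) \<Rightarrow> ('v option \<Rightarrow> 'v list) \<Rightarrow> bool" where
  "planar_structure V par ord \<longleftrightarrow>
     (\<forall>x. (x = None \<or> (\<exists>u\<in>V. x = Some u)) \<longrightarrow> distinct (ord x) \<and> set (ord x) = {v \<in> V. par v = x}) \<and>
     (\<forall>x. \<not> (x = None \<or> (\<exists>u\<in>V. x = Some u)) \<longrightarrow> ord x = [])"

text \<open>The planar tree below v (depth bounded by the fuel n, which is sufficient for n = card V).\<close>
fun build :: "('v option \<Rightarrow> 'v list) \<Rightarrow> ('v \<Rightarrow> 'a) \<Rightarrow> nat \<Rightarrow> 'v \<Rightarrow> 'a ptree" where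
  "build ord phi 0 v = Node (phi v) []"
| "build ord phi (Suc n) v = Node (phi v) (map (build ord phi n) (ord (Some v)))"

definition planar_of :: "'v set \<Rightarrow> ('v option \<Rightarrow> 'v list) \<Rightarrow> ('v \<Rightarrow> 'a) \<Rightarrow> 'a pforest" where
  "planar_of V ord phi = map (build ord phi (card V)) (ord None)"

definition Sym :: "'v set \<Rightarrow> ('v \<Rightarrow> 'v option) \<Rightarrow> ('v \<Rightarrow> 'a) \<Rightarrow> 'a pforest \<Rightarrow> nat" where
  "Sym V par phi \<sigma> = card {ord. planar_structure V par ord \<and> planar_of V ord phi = \<sigma>}"

definition Omega :: "'v set \<Rightarrow> ('v \<Rightarrow> 'v option) \<Rightarrow> ('v \<Rightarrow> 'a) \<Rightarrow> ('a pforest \<Rightarrow>\<^sub>0 'k::field)" where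
  "Omega V par phi = (\<Sum>\<sigma>\<in>{planar_of V ord phi | ord. planar_structure V par ord}.
      smult (of_nat (Sym V par phi \<sigma>)) (vsingle \<sigma>))"

end

(* For <<, the rightmost root of a forest G B_a(H) is the least vertex, and above it the vertices
   of G and those of H are incomparable; hence arb(G B_a(H)) = (arb G sh arb H) a.  With the
   recursion of the shuffle product on last letters this gives multiplicativity, and ladders give
   surjectivity.

   For the coproduct, cutting a linear extension in two amounts to choosing a downward closed
   set W, a linear extension of its complement and one of W, and the linear extensions of the
   complement are the shuffles of those of its components.  It remains that << on the forest
   induced on W, or on a component C of the complement, is the restriction of <<.  This fails for
   arbitrary vertex sets; it holds for W and C because they are convex and their roots are
   siblings.

   For Omega, every linear extension of the forest order of a non-planar forest is a linear
   extension of << for exactly one planar structure: the one ordering siblings as they occur in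
   the extension. *)

theory Submission
  imports Defs
begin

text \<open>Restriction of << can fail in two ways. Children of two different roots are
  incomparable, yet without the rest of the forest they become roots and hence comparable. In a
  ladder of three vertices, keeping only the root and the leaf makes both of them roots, and their
  order is reversed. An induced forest also gives its vertices new paths, just as a planar structure
  gives paths to abstract vertices. Both are therefore treated as one construction, the unfolding of
  a vertex set with a parent map and sibling orders. There << is generated by parent-child and
  sibling pairs, and a linear extension has only to respect the generators. Components are
  controlled by a further fact: << is itself a forest order, because what lies below a vertex is a
  chain. Two vertices of one component thus have a common lower bound, and in an upward closed set
  this forces the roots of a component to be siblings. Words are collected in multisets, which keeps
  the field out of the combinatorics and shows the coefficients to be natural numbers.\<close>

section \<open>Shuffles of multisets of words\<close>

text \<open>The shuffle product on nonnegative integer combinations of words;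
  \<open>shmult_msv\<close> carries it to the vector space over any field.\<close>

definition msh :: "'x list multiset \<Rightarrow> 'x list multiset \<Rightarrow> 'x list multiset" where
  "msh M N = (\<Sum>x\<in>#M. \<Sum>y\<in>#N. shuffle_ms x y)"

lemma shuffle_ms_Nil_right [simp]: "shuffle_ms xs [] = {#xs#}"
  by (cases xs) auto

lemma msh_simps [simp]:
  "msh {#} N = {#}" "msh M {#} = {#}"
  "msh (M + M') N = msh M N + msh M' N"
  "msh M (N + N') = msh M N + msh M N'"
  "msh {#x#} {#y#} = shuffle_ms x y"
  by (simp_all add: msh_def sum_mset.distrib)

text \<open>Plays the part of linearity: \<open>msh\<close> is additive in each argument, so its
  laws can be checked on singletons.\<close>

lemma multiset_union_induct [case_names empty single union]:
  assumes "P {#}" "\<And>x. P {#x#}" "\<And>M N. P M \<Longrightarrow> P N \<Longrightarrow> P (M + N)"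
  shows "P M"
proof (induction M)
  case (add x M)
  from assms(3)[OF this assms(2)[of x]] show ?case by simp
qed (rule assms)

lemma msh_unit [simp]: "msh {#[]#} N = N" "msh N {#[]#} = N"
  by (induction N rule: multiset_union_induct) simp_all

lemma shuffle_ms_commute: "shuffle_ms xs ys = shuffle_ms ys xs"
  by (induction xs ys rule: shuffle_ms.induct) (simp_all add: add.commute)

lemma msh_commute: "msh M N = msh N M"
proof (induction M rule: multiset_union_induct)
  case (single x)
  show ?case
    by (induction N rule: multiset_union_induct) (simp_all add: shuffle_ms_commute)
qed simp_all

text \<open>Lets the first-letter recursion act when one factor is a whole sum of words with a
  common first letter, as in iterated shuffles.\<close>

lemma msh_Cons_single:
  "msh (image_mset ((#) x) M) {#z # zs#} =
     image_mset ((#) x) (msh M {#z # zs#}) + image_mset ((#) z) (msh (image_mset ((#) x) M) {#zs#})"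
  by (induction M rule: multiset_union_induct) simp_all

lemma msh_single_Cons:
  "msh {#z # zs#} (image_mset ((#) x) M) =
     image_mset ((#) x) (msh {#z # zs#} M) + image_mset ((#) z) (msh {#zs#} (image_mset ((#) x) M))"
  by (metis msh_Cons_single msh_commute)

text \<open>The first letter of a threefold shuffle comes from one of the three words. Removing it
  lowers the total length, and both bracketings produce the same three summands.\<close>

lemma shuffle_ms_assoc:
  "msh (shuffle_ms xs ys) {#zs#} = msh {#xs#} (shuffle_ms ys zs)"
proof (induction "length xs + length ys + length zs" arbitrary: xs ys zs rule: less_induct)
  case less
  show ?case
  proof (cases xs; cases ys; cases zs)
    fix x xs' y ys' z zs'
    assume e: "xs = x # xs'" "ys = y # ys'" "zs = z # zs'"
    have 1: "msh (shuffle_ms xs' ys) {#zs#} = msh {#xs'#} (shuffle_ms ys zs)"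
      and 2: "msh (shuffle_ms xs ys') {#zs#} = msh {#xs#} (shuffle_ms ys' zs)"
      and 3: "msh (shuffle_ms xs ys) {#zs'#} = msh {#xs#} (shuffle_ms ys zs')"
      by (rule less; simp add: e)+
    have "image_mset ((#) x) (msh (shuffle_ms xs' ys) {#zs#}) =
        image_mset ((#) x) (msh {#xs'#} (shuffle_ms ys zs))"
      "image_mset ((#) y) (msh (shuffle_ms xs ys') {#zs#}) =
        image_mset ((#) y) (msh {#xs#} (shuffle_ms ys' zs))"
      "image_mset ((#) z) (msh (shuffle_ms xs ys) {#zs'#}) =
        image_mset ((#) z) (msh {#xs#} (shuffle_ms ys zs'))"
      by (simp_all only: 1 2 3)
    then show ?thesis
      by (simp add: e msh_Cons_single msh_single_Cons add_ac)
  qed simp_all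
qed

lemma msh_assoc: "msh (msh M N) K = msh M (msh N K)"
proof (induction M rule: multiset_union_induct)
  case (single x)
  show ?case
  proof (induction N rule: multiset_union_induct)
    case (single y)
    show ?case
      by (induction K rule: multiset_union_induct) (simp_all add: shuffle_ms_assoc)
  qed simp_all
qed simp_all

section \<open>The shuffle recursion on last letters\<close>

lemma shuffle_ms_single_snoc:
  "shuffle_ms [a] (ys @ [b]) = {#ys @ [b, a]#} + image_mset (\<lambda>w. w @ [b]) (shuffle_ms [a] ys)"
  by (induction ys) (simp_all add: image_mset.compositionality o_def add_ac)

text \<open>\<open>shuffle_ms\<close> peels off first letters, whereas a root that is least for <<
  contributes the last letter of a word. The recursion at the other end follows by expanding first
  letters and regrouping.\<close>

lemma shuffle_ms_snoc:
  "shuffle_ms (xs @ [a]) (ys @ [b]) =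
     image_mset (\<lambda>w. w @ [a]) (shuffle_ms xs (ys @ [b])) +
     image_mset (\<lambda>w. w @ [b]) (shuffle_ms (xs @ [a]) ys)"
proof (induction xs ys rule: shuffle_ms.induct)
  case (1 ys) then show ?case using shuffle_ms_single_snoc[of a ys b] by simp
next
  case (2 x xs)
  then show ?case 
    using shuffle_ms_single_snoc[of b "x # xs" a]
    by (simp add: shuffle_ms_commute[of _ "[b]"] image_mset.compositionality o_def add_ac)
next
  case (3 x xs y ys)
  then show ?case by (simp add: image_mset.compositionality o_def add_ac)
qed

lemma msh_snoc:
  "msh (image_mset (\<lambda>w. w @ [a]) M) (image_mset (\<lambda>w. w @ [b]) N) =
     image_mset (\<lambda>w. w @ [a]) (msh M (image_mset (\<lambda>w. w @ [b]) N)) +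
     image_mset (\<lambda>w. w @ [b]) (msh (image_mset (\<lambda>w. w @ [a]) M) N)"
proof (induction M rule: multiset_union_induct)
  case (single x)
  show ?case
    by (induction N rule: multiset_union_induct) (simp_all add: shuffle_ms_snoc)
qed simp_all

lemma image_mset_shuffle_ms:
  "image_mset (map f) (shuffle_ms xs ys) = shuffle_ms (map f xs) (map f ys)"
proof (induction xs ys rule: shuffle_ms.induct)
  case (3 x xs y ys)
  from 3[symmetric] show ?case by (simp add: image_mset.compositionality o_def)
qed simp_all

lemma image_mset_msh:
  "image_mset (map f) (msh M N) = msh (image_mset (map f) M) (image_mset (map f) N)"
proof (induction M rule: multiset_union_induct)
  case (single x)
  show ?case
    by (induction N rule: multiset_union_induct) (simp_all add: image_mset_shuffle_ms)
qed simp_all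

section \<open>Linear extension of maps on bases\<close>

lemma lookup_smult [simp]: "Poly_Mapping.lookup (smult c u) x = c * Poly_Mapping.lookup u x"
  by (simp add: smult_def map.rep_eq when_def)

lemma smult_simps [simp]:
  "smult c (0 :: 'b \<Rightarrow>\<^sub>0 'k::field) = 0" "smult 0 u = 0" "smult 1 u = u"
  "smult c (smult d u) = smult (c * d) u"
  for u :: "'b \<Rightarrow>\<^sub>0 'k::field"
  by (rule poly_mapping_eqI; simp)+

lemma smult_add: "smult c (u + v) = smult c u + smult c v" "smult (c + d) u = smult c u + smult d u"
  by (rule poly_mapping_eqI; simp add: lookup_add algebra_simps)+

lemma smult_sum: "smult c (sum f S) = (\<Sum>x\<in>S. smult c (f x))"
  by (induction S rule: infinite_finite_induct) (simp_all add: smult_add)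

lemma single_eq_smult: "Poly_Mapping.single x c = smult c (vsingle x)"
  by (rule poly_mapping_eqI) (simp add: vsingle_def lookup_single when_def)

text \<open>The sum in \<open>lin\<close> runs over the support of its argument, which changes under
  addition and scaling; a common superset makes such sums comparable.\<close>

lemma lin_superset:
  assumes "finite S" "Poly_Mapping.keys u \<subseteq> S"
  shows "lin f u = (\<Sum>x\<in>S. smult (Poly_Mapping.lookup u x) (f x))"
  unfolding lin_def using assms
  by (intro sum.mono_neutral_left) (auto simp: in_keys_iff)

lemma lin_add: "lin f (u + v) = lin f u + lin f v"
proof -
  let ?S = "Poly_Mapping.keys u \<union> Poly_Mapping.keys v"
  have "Poly_Mapping.keys (u + v) \<subseteq> ?S" by (rule Poly_Mapping.keys_add)
  then show ?thesis
    by (simp add: lin_superset[of ?S] lookup_add smult_add sum.distrib)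
qed

lemma lin_smult: "lin f (smult c u) = smult c (lin f u)"
proof -
  have "Poly_Mapping.keys (smult c u) \<subseteq> Poly_Mapping.keys u"
    by (auto simp: in_keys_iff)
  then show ?thesis
    by (simp add: lin_superset[of "Poly_Mapping.keys u"] smult_sum)
qed

lemma lin_zero [simp]: "lin f 0 = 0"
  by (simp add: lin_def)

lemma lin_vsingle [simp]: "lin f (vsingle x) = f x"
  by (simp add: lin_def vsingle_def)

lemma lin_fun_zero [simp]: "lin (\<lambda>x. 0) u = 0"
  by (simp add: lin_def)

lemma lin_sum: "lin f (sum g S) = (\<Sum>x\<in>S. lin f (g x))"
  by (induction S rule: infinite_finite_induct) (simp_all add: lin_add)

lemma lin_fun_add: "lin (\<lambda>x. f x + g x) u = lin f u + lin g u"
  by (simp add: lin_def smult_add sum.distrib)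

lemma lin_fun_smult: "lin (\<lambda>x. smult c (f x)) u = smult c (lin f u)"
  by (simp add: lin_def smult_sum mult.commute)

lemma vector_induct [case_names zero vsingle add smult]:
  assumes "P 0" "\<And>x. P (vsingle x)" "\<And>u v. P u \<Longrightarrow> P v \<Longrightarrow> P (u + v)"
    "\<And>c u. P u \<Longrightarrow> P (smult c u)"
  shows "P (u :: 'b \<Rightarrow>\<^sub>0 'k::field)"
proof -
  have "u = (\<Sum>x\<in>Poly_Mapping.keys u. smult (Poly_Mapping.lookup u x) (vsingle x))"
    by (rule poly_mapping_eqI)
       (simp add: lookup_sum vsingle_def lookup_single when_def if_distrib in_keys_iff cong: if_cong)
  moreover have "P (\<Sum>x\<in>S. smult (Poly_Mapping.lookup u x) (vsingle x))" for S
    by (induction S rule: infinite_finite_induct) (use assms in auto)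
  ultimately show ?thesis by metis
qed

text \<open>Bilinear constructions become iterated linear ones and inherit their laws from
  \<open>lin\<close>.\<close>

lemma bilin_eq_lin: "bilin m u v = lin (\<lambda>x. lin (m x) v) u"
  by (simp add: bilin_def lin_def smult_sum)

lemma tensor_eq_lin: "tensor u v = lin (\<lambda>x. lin (\<lambda>y. vsingle (x, y)) v) u"
  by (simp add: tensor_def lin_def smult_sum single_eq_smult)

lemma tmap_tensor:
  assumes "\<And>u v. f (u + v) = f u + f v" "\<And>c u. f (smult c u) = smult c (f u)"
  shows "tmap f (tensor u v) = tensor (f u) (f v)"
proof -
  have f0: "f 0 = 0" using assms(2)[of 0 0] by simp
  show ?thesis
  proof (induction u rule: vector_induct)
    case (vsingle x)
    show ?case
      by (induction v rule: vector_induct)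
         (simp_all add: tensor_eq_lin tmap_def lin_add lin_smult assms f0 lin_fun_add lin_fun_smult)
  qed (simp_all add: tensor_eq_lin tmap_def lin_add lin_smult assms f0)
qed

lemma lookup_msv [simp]: "Poly_Mapping.lookup (msv M) x = of_nat (count M x)"
  by (simp add: msv_def lookup_sum lookup_single when_def not_in_iff)

lemma msv_simps [simp]: "msv {#} = 0" "msv {#x#} = vsingle x" "msv (M + N) = msv M + msv N"
  by (rule poly_mapping_eqI; simp add: lookup_add vsingle_def lookup_single when_def)+

lemma msv_add_mset: "msv (add_mset x M) = vsingle x + msv M"
  by (metis add_mset_add_single msv_simps(2,3) add.commute)

lemma msv_mset_set: "finite S \<Longrightarrow> msv (image_mset f (mset_set S)) = (\<Sum>x\<in>S. vsingle (f x))"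
  by (induction S rule: finite_induct) (simp_all add: msv_add_mset)

lemma lin_msv: "lin f (msv M) = (\<Sum>x\<in>#M. f x)"
  by (induction M) (simp_all add: msv_add_mset lin_add)

lemma msv_sum_mset: "msv (\<Sum>x\<in>#M. f x) = (\<Sum>x\<in>#M. msv (f x))"
  by (induction M) simp_all

lemma shmult_msv: "shmult (msv M) (msv N) = msv (msh M N)"
  by (simp add: shmult_def bilin_eq_lin lin_msv msh_def msv_sum_mset)

lemma tensor_msv: "tensor (msv M) (msv N) = (\<Sum>x\<in>#M. \<Sum>y\<in>#N. vsingle (x, y))"
  by (simp add: tensor_eq_lin lin_msv)

lemma shmult_linear:
  "shmult (u + u') v = shmult u v + shmult u' v" "shmult u (v + v') = shmult u v + shmult u v'"
  "shmult (smult c u) v = smult c (shmult u v)" "shmult u (smult c v) = smult c (shmult u v)"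
  "shmult 0 v = 0" "shmult u 0 = 0"
  by (simp_all add: shmult_def bilin_eq_lin lin_add lin_smult lin_fun_add lin_fun_smult)

lemma shmult_vsingle: "shmult (vsingle x) (vsingle y) = msv (shuffle_ms x y)"
  by (simp add: shmult_def bilin_eq_lin)

lemma lin_shmult:
  assumes "\<And>x y. lin f (msv (shuffle_ms x y)) = shmult (f x) (f y)"
  shows "lin f (shmult u v) = shmult (lin f u) (lin f v)"
proof (induction u rule: vector_induct)
  case (vsingle x)
  show ?case
  proof (induction v rule: vector_induct)
    case (vsingle y)
    then show ?case by (simp add: shmult_vsingle assms)
  qed (simp_all add: shmult_linear lin_add lin_smult)
qed (simp_all add: shmult_linear lin_add lin_smult)

section \<open>Linear extensions of relations\<close>

definition lext :: "'v set \<Rightarrow> ('v \<Rightarrow> 'v \<Rightarrow> bool) \<Rightarrow> 'v list set" where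
  "lext A R = {vs. distinct vs \<and> set vs = A \<and>
     (\<forall>i j. i < length vs \<and> j < length vs \<and> R (vs ! i) (vs ! j) \<longrightarrow> i > j)}"

text \<open>A multiset, since different extensions can carry the same word.\<close>

definition wext :: "'v set \<Rightarrow> ('v \<Rightarrow> 'v \<Rightarrow> bool) \<Rightarrow> ('v \<Rightarrow> 'a) \<Rightarrow> 'a list multiset" where
  "wext A R \<phi> = image_mset (map \<phi>) (mset_set (lext A R))"

lemma finite_lext [simp]: "finite (lext A R)"
proof (cases "finite A")
  case True
  then show ?thesis
    by (rule finite_subset[rotated, OF finite_subset_distinct]) (auto simp: lext_def)
next
  case False
  then have "lext A R = {}" by (auto simp: lext_def)
  then show ?thesis by simp
qed

lemma set_lext: "vs \<in> lext A R \<Longrightarrow> set vs = A"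
  by (simp add: lext_def)

lemma distinct_lext: "vs \<in> lext A R \<Longrightarrow> distinct vs"
  by (simp add: lext_def)

lemma lext_empty [simp]: "lext {} R = {[]}"
  by (auto simp: lext_def)

lemma wext_empty [simp]: "wext {} R \<phi> = {#[]#}"
  by (simp add: wext_def)

text \<open>The definition of \<open>lext\<close> also constrains the pairs \<open>i = j\<close>,
  which \<open>sorted_wrt\<close> never inspects; irreflexivity on \<open>A\<close> closes this
  gap.\<close>

lemma lext_iff_sorted_wrt:
  assumes "\<And>x. x \<in> A \<Longrightarrow> \<not> R x x"
  shows "vs \<in> lext A R \<longleftrightarrow> distinct vs \<and> set vs = A \<and> sorted_wrt (\<lambda>x y. \<not> R x y) vs"
proof (cases "set vs = A")
  case True
  have irr: "\<not> R (vs ! i) (vs ! i)" if "i < length vs" for i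
    using that True assms by auto
  have "(\<forall>i j. i < length vs \<and> j < length vs \<and> R (vs ! i) (vs ! j) \<longrightarrow> i > j) \<longleftrightarrow>
      sorted_wrt (\<lambda>x y. \<not> R x y) vs" (is "?L \<longleftrightarrow> ?R")
  proof
    show "?L \<Longrightarrow> ?R" unfolding sorted_wrt_iff_nth_less by (meson less_asym less_trans)
    assume ?R
    show ?L
    proof (intro allI impI)
      fix i j assume *: "i < length vs \<and> j < length vs \<and> R (vs ! i) (vs ! j)"
      with irr have "i \<noteq> j" by auto
      moreover have "\<not> i < j" using * \<open>?R\<close> by (auto simp: sorted_wrt_iff_nth_less)
      ultimately show "i > j" by simp
    qed
  qed
  with True show ?thesis by (simp add: lext_def)
qed (simp add: lext_def)

text \<open>Each step of an \<open>R\<close>-path moves strictly to the left in the list;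
  \<open>RA\<close> ensures that the intermediate points occur in the list.\<close>

lemma lext_mono_tranclp:
  assumes SR: "\<And>x y. x \<in> A \<Longrightarrow> y \<in> A \<Longrightarrow> S x y \<Longrightarrow> R\<^sup>+\<^sup>+ x y"
    and RA: "\<And>x y. R x y \<Longrightarrow> x \<in> A"
  shows "lext A R \<subseteq> lext A S"
proof
  fix vs assume vs: "vs \<in> lext A R"
  have pos: "R\<^sup>+\<^sup>+ x y \<Longrightarrow> i < length vs \<Longrightarrow> vs ! i = x \<Longrightarrow> j < length vs \<Longrightarrow> vs ! j = y \<Longrightarrow> j < i"
    for x y i j
  proof (induction arbitrary: j rule: tranclp_induct)
    case (base y)
    then show ?case using vs by (auto simp: lext_def)
  next
    case (step y z)
    from RA[OF step.hyps(2)] vs obtain k where k: "k < length vs" "vs ! k = y"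
      by (auto simp: lext_def in_set_conv_nth)
    from step.IH[OF step.prems(1,2) k] have "k < i" .
    moreover have "j < k" using k step vs by (auto simp: lext_def)
    ultimately show ?case by simp
  qed
  have "j < i" if "i < length vs" "j < length vs" "S (vs ! i) (vs ! j)" for i j
    by (rule pos[OF SR that(1) refl that(2) refl]) (use that vs in \<open>auto simp: lext_def\<close>)
  then show "vs \<in> lext A S"
    using vs by (simp add: lext_def)
qed

lemma lext_tranclp:
  assumes "\<And>x y. R x y \<Longrightarrow> x \<in> A"
  shows "lext A (R\<^sup>+\<^sup>+) = lext A R"
proof (rule antisym)
  show "lext A (R\<^sup>+\<^sup>+) \<subseteq> lext A R" by (auto simp: lext_def)
  show "lext A R \<subseteq> lext A (R\<^sup>+\<^sup>+)" by (rule lext_mono_tranclp) (use assms in auto)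
qed

lemma lext_bij_betw:
  assumes bij: "bij_betw f A B"
    and R: "\<And>x y. x \<in> A \<Longrightarrow> y \<in> A \<Longrightarrow> R x y \<longleftrightarrow> S (f x) (f y)"
  shows "lext B S = map f ` lext A R"
proof -
  have inj: "inj_on f A" and B: "B = f ` A" using bij by (auto simp: bij_betw_def)
  have *: "map f vs \<in> lext B S \<longleftrightarrow> vs \<in> lext A R" if "set vs \<subseteq> A" for vs
  proof -
    have 1: "f ` set vs = f ` A \<longleftrightarrow> set vs = A"
      using inj that by (simp add: inj_on_image_eq_iff)
    have 2: "inj_on f (set vs)" using inj that by (rule inj_on_subset)
    have "S (f (vs ! i)) (f (vs ! j)) \<longleftrightarrow> R (vs ! i) (vs ! j)"
      if "i < length vs" "j < length vs" for i j
      using that \<open>set vs \<subseteq> A\<close> by (intro R[symmetric]) auto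
    then show ?thesis
      by (simp add: lext_def distinct_map B 1 2 cong: conj_cong)
  qed
  show ?thesis
  proof (intro equalityI subsetI)
    fix ws assume ws: "ws \<in> lext B S"
    then have "ws \<in> lists (f ` A)" by (auto simp: lext_def B)
    then obtain vs where "ws = map f vs" "set vs \<subseteq> A"
      by (auto simp: lists_image)
    with ws *[of vs] show "ws \<in> map f ` lext A R" by blast
  next
    fix ws assume "ws \<in> map f ` lext A R"
    then obtain vs where "vs \<in> lext A R" "ws = map f vs" by blast
    moreover from this have "set vs \<subseteq> A" by (simp add: lext_def)
    ultimately show "ws \<in> lext B S" using *[of vs] by blast
  qed
qed

text \<open>Words see vertices only through the relation and the labels, so vertices may be renamed,
  for instance when a subforest gets new paths.\<close>

lemma wext_bij_betw:
  assumes bij: "bij_betw f A B"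
    and R: "\<And>x y. x \<in> A \<Longrightarrow> y \<in> A \<Longrightarrow> R x y \<longleftrightarrow> S (f x) (f y)"
    and \<phi>: "\<And>x. x \<in> A \<Longrightarrow> \<phi> x = \<psi> (f x)"
  shows "wext A R \<phi> = wext B S \<psi>"
proof -
  have "inj_on (map f) (lext A R)"
    by (intro inj_on_mapI inj_on_subset[OF bij_betw_imp_inj_on[OF bij]]) (auto simp: lext_def)
  then have "mset_set (lext B S) = image_mset (map f) (mset_set (lext A R))"
    by (simp add: lext_bij_betw[of f A B R S, OF bij R] image_mset_mset_set)
  then show ?thesis
    by (simp add: wext_def image_mset.compositionality o_def)
       (rule image_mset_cong, auto simp: \<phi> dest: set_lext)
qed

text \<open>Common source of two arguments: \<open>vs = [r]\<close> splits off a last letter, and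
  arbitrary \<open>vs\<close> describes every cut of an extension.\<close>

lemma lext_append_iff:
  assumes "\<And>x. x \<in> A \<Longrightarrow> \<not> R x x"
  shows "us @ vs \<in> lext A R \<longleftrightarrow> set vs \<subseteq> A \<and> us \<in> lext (A - set vs) R \<and> vs \<in> lext (set vs) R
     \<and> (\<forall>x\<in>A - set vs. \<forall>y\<in>set vs. \<not> R x y)"
proof (cases "set vs \<subseteq> A")
  case True
  have 0: "us @ vs \<in> lext A R \<longleftrightarrow>
    distinct (us @ vs) \<and> set (us @ vs) = A \<and> sorted_wrt (\<lambda>x y. \<not> R x y) (us @ vs)"
    by (rule lext_iff_sorted_wrt) (rule assms)
  have *: "us \<in> lext (A - set vs) R \<longleftrightarrow>
    distinct us \<and> set us = A - set vs \<and> sorted_wrt (\<lambda>x y. \<not> R x y) us"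
    "vs \<in> lext (set vs) R \<longleftrightarrow> distinct vs \<and> sorted_wrt (\<lambda>x y. \<not> R x y) vs"
    using assms True by (subst lext_iff_sorted_wrt; auto)+
  show ?thesis
    unfolding * 0 using True by (auto simp: sorted_wrt_append)
next
  case False
  then show ?thesis by (auto simp: lext_def)
qed

lemma lext_insert_min:
  assumes r: "r \<notin> A" "\<And>x. x \<in> A \<Longrightarrow> R r x" "\<And>x. x \<in> A \<Longrightarrow> \<not> R x r" "\<not> R r r"
    and irr: "\<And>x. x \<in> A \<Longrightarrow> \<not> R x x"
  shows "lext (insert r A) R = (\<lambda>vs. vs @ [r]) ` lext A R"
proof -
  have irr': "\<And>x. x \<in> insert r A \<Longrightarrow> \<not> R x x" using r irr by auto
  have sr: "[r] \<in> lext {r} R" using r by (auto simp: lext_def)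
  have snoc: "vs @ [r] \<in> lext (insert r A) R \<longleftrightarrow> vs \<in> lext A R" for vs
    by (subst lext_append_iff[of "insert r A" R, OF irr']) (use r sr in auto)
  show ?thesis
  proof (intro equalityI subsetI)
    fix ws assume ws: "ws \<in> lext (insert r A) R"
    then have "ws \<noteq> []" by (auto simp: lext_def)
    then obtain vs x where e: "ws = vs @ [x]" by (metis append_butlast_last_id)
    with ws have "x \<in> insert r A" "r \<in> insert r A" by (auto simp: lext_def)
    \<comment> \<open>If the last element were not \<open>r\<close>, then \<open>r\<close> would
      stand before an element above it.\<close>
    moreover have "\<not> R r x" if "x \<noteq> r"
      using ws that unfolding e by (subst (asm) lext_append_iff[of "insert r A" R, OF irr']) auto
    ultimately have "x = r" using r by auto
    with ws e snoc show "ws \<in> (\<lambda>vs. vs @ [r]) ` lext A R" by auto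
  qed (use snoc in auto)
qed

lemma wext_insert_min:
  assumes "r \<notin> A" "\<And>x. x \<in> A \<Longrightarrow> R r x" "\<And>x. x \<in> A \<Longrightarrow> \<not> R x r" "\<not> R r r"
    and "\<And>x. x \<in> A \<Longrightarrow> \<not> R x x"
  shows "wext (insert r A) R \<phi> = image_mset (\<lambda>w. w @ [\<phi> r]) (wext A R \<phi>)"
proof -
  have "inj_on (\<lambda>vs. vs @ [r]) (lext A R)" by (auto simp: inj_on_def)
  then show ?thesis
    by (simp add: wext_def lext_insert_min[of r A R, OF assms] image_mset.compositionality o_def
        flip: image_mset_mset_set)
qed

text \<open>With distinct, disjoint letters no word arises twice, because the two branches of the
  recursion differ in their first letter. Multiplicities appear only after labelling.\<close>

lemma shuffle_ms_eq_mset_set: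
  assumes "distinct xs" "distinct ys" "set xs \<inter> set ys = {}"
  shows "shuffle_ms xs ys = mset_set (shuffles xs ys)"
  using assms
proof (induction xs ys rule: shuffle_ms.induct)
  case (3 x xs y ys)
  have "(#) x ` shuffles xs (y # ys) \<inter> (#) y ` shuffles (x # xs) ys = {}"
    using 3 by auto
  then show ?case using 3
    by (simp add: mset_set_Union image_mset_mset_set inj_on_def)
qed simp_all

text \<open>When nothing relates \<open>A\<close> to \<open>B\<close>, the order conditions on an
  interleaving are exactly those on its two parts.\<close>

lemma lext_Un_partition:
  assumes "A \<inter> B = {}" and "\<And>x y. x \<in> A \<Longrightarrow> y \<in> B \<Longrightarrow> \<not> R x y \<and> \<not> R y x"
    and irr: "\<And>x. x \<in> A \<union> B \<Longrightarrow> \<not> R x x"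
  shows "lext (A \<union> B) R = (\<Union>us\<in>lext A R. \<Union>vs\<in>lext B R. shuffles us vs)"
proof -
  have sorted: "sorted_wrt P ws \<longleftrightarrow> sorted_wrt P us \<and> sorted_wrt P vs"
    if "ws \<in> shuffles us vs" "\<And>x y. x \<in> set us \<Longrightarrow> y \<in> set vs \<Longrightarrow> P x y \<and> P y x"
    for ws us vs :: "'a list" and P
    using that
  proof (induction us vs arbitrary: ws rule: shuffles.induct)
    case (3 x xs y ys)
    from 3(3) consider zs where "ws = x # zs" "zs \<in> shuffles xs (y # ys)"
      | zs where "ws = y # zs" "zs \<in> shuffles (x # xs) ys" by auto
    then show ?case
    proof cases
      case 1
      then show ?thesis using 3(1)[OF 1(2)] 3(4) set_shuffles[OF 1(2)] by auto
    next
      case 2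
      then show ?thesis using 3(2)[OF 2(2)] 3(4) set_shuffles[OF 2(2)] by auto
    qed
  qed auto
  have "vs \<in> lext C R \<longleftrightarrow> distinct vs \<and> set vs = C \<and> sorted_wrt (\<lambda>x y. \<not> R x y) vs"
    if "C \<subseteq> A \<union> B" for vs C
    using that irr by (intro lext_iff_sorted_wrt) auto
  note iff = this[OF order_refl] this[OF Un_upper1] this[OF Un_upper2]
  show ?thesis
  proof (intro equalityI subsetI)
    fix ws assume ws: "ws \<in> lext (A \<union> B) R"
    let ?u = "filter (\<lambda>x. x \<in> A) ws" and ?v = "filter (\<lambda>x. x \<notin> A) ws"
    have "ws \<in> shuffles ?u ?v" by (rule partition_in_shuffles)
    moreover have "?u \<in> lext A R" "?v \<in> lext B R"
      using ws assms(1)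
      by (auto simp: iff intro: sorted_wrt_filter)
    ultimately show "ws \<in> (\<Union>us\<in>lext A R. \<Union>vs\<in>lext B R. shuffles us vs)" by blast
  next
    fix ws assume "ws \<in> (\<Union>us\<in>lext A R. \<Union>vs\<in>lext B R. shuffles us vs)"
    then obtain us vs where *: "us \<in> lext A R" "vs \<in> lext B R" "ws \<in> shuffles us vs" by auto
    then have s: "set us = A" "set vs = B" "distinct us" "distinct vs" by (auto simp: lext_def)
    have "sorted_wrt (\<lambda>x y. \<not> R x y) ws"
      using * s assms(2) by (subst sorted[OF *(3)])
        (auto simp: iff)
    then show "ws \<in> lext (A \<union> B) R"
      using set_shuffles[OF *(3)] distinct_disjoint_shuffles[OF s(3,4) _ *(3)] s assms(1)
      by (simp add: iff)
  qed
qed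

lemma mset_set_Union_disjoint:
  assumes "finite I" "\<And>i. i \<in> I \<Longrightarrow> finite (F i)"
    "\<And>i j. i \<in> I \<Longrightarrow> j \<in> I \<Longrightarrow> i \<noteq> j \<Longrightarrow> F i \<inter> F j = {}"
  shows "mset_set (\<Union>i\<in>I. F i) = (\<Sum>i\<in>#mset_set I. mset_set (F i))"
  using assms
proof (induction I rule: finite_induct)
  case (insert i I)
  then have "F i \<inter> (\<Union>i\<in>I. F i) = {}" by blast
  with insert show ?case by (simp add: mset_set_Union)
qed simp

lemma wext_Un:
  assumes AB: "A \<inter> B = {}" and R: "\<And>x y. x \<in> A \<Longrightarrow> y \<in> B \<Longrightarrow> \<not> R x y \<and> \<not> R y x"
    and irr: "\<And>x. x \<in> A \<union> B \<Longrightarrow> \<not> R x x"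
  shows "wext (A \<union> B) R \<phi> = msh (wext A R \<phi>) (wext B R \<phi>)"
proof -
  \<comment> \<open>A shuffle remembers its two factors, which filtering by \<open>A\<close>
    recovers. Hence the unions below are disjoint and multiplicities add up.\<close>
  have u: "filter (\<lambda>x. x \<in> A) ws = us \<and> filter (\<lambda>x. x \<notin> A) ws = vs"
    if "us \<in> lext A R" "vs \<in> lext B R" "ws \<in> shuffles us vs" for us vs ws
    using that AB filter_shuffles_disjoint1[of us vs ws] filter_shuffles_disjoint2[of us vs ws]
    by (auto simp: lext_def intro: filter_cong)
  have part: "lext (A \<union> B) R = (\<Union>us\<in>lext A R. \<Union>vs\<in>lext B R. shuffles us vs)"
    by (rule lext_Un_partition) (use assms in blast)+
  have "mset_set (lext (A \<union> B) R) =
      (\<Sum>us\<in>#mset_set (lext A R). mset_set (\<Union>vs\<in>lext B R. shuffles us vs))"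
    unfolding part by (rule mset_set_Union_disjoint) (auto, metis u)
  also have "\<dots> = (\<Sum>us\<in>#mset_set (lext A R). \<Sum>vs\<in>#mset_set (lext B R). mset_set (shuffles us vs))"
    by (intro arg_cong[where f = sum_mset] image_mset_cong mset_set_Union_disjoint)
       (auto, metis u)
  also have "\<dots> = (\<Sum>us\<in>#mset_set (lext A R). \<Sum>vs\<in>#mset_set (lext B R). shuffle_ms us vs)"
    by (intro arg_cong[where f = sum_mset] image_mset_cong shuffle_ms_eq_mset_set[symmetric])
       (use AB in \<open>auto dest: set_lext distinct_lext\<close>)
  finally have "mset_set (lext (A \<union> B) R) = msh (mset_set (lext A R)) (mset_set (lext B R))"
    by (simp add: msh_def)
  then show ?thesis by (simp add: wext_def image_mset_msh)
qed

section \<open>The order on the vertices of a planar forest\<close>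

text \<open>Induction along the decomposition that removes the rightmost root, the least vertex for
  <<.\<close>

lemma pforest_induct [case_names Nil snoc]:
  assumes "P []" "\<And>G a H. P G \<Longrightarrow> P H \<Longrightarrow> P (G @ [Node a H])"
  shows "P F"
proof (induction F rule: measure_induct_rule[of "size_list size"])
  case (less F)
  show ?case
  proof (cases F rule: rev_cases)
    case (snoc G t)
    then show ?thesis using less assms(2) by (cases t) auto
  qed (simp add: assms)
qed

lemma sub_Cons:
  "sub F (i # q) =
     (if i < length F then if q = [] then Some (F ! i) else sub (children (F ! i)) q else None)"
  by (cases q) auto

lemma verts_Nil [simp]: "[] \<notin> verts F"
  by (simp add: verts_def)

lemma verts_Cons:
  "i # q \<in> verts F \<longleftrightarrow> i < length F \<and> (q = [] \<or> q \<in> verts (children (F ! i)))"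
  by (simp add: verts_def sub_Cons)

lemma verts_Nil_forest [simp]: "verts [] = {}"
proof -
  have "p \<notin> verts []" for p by (cases p) (auto simp: verts_Cons)
  then show ?thesis by blast
qed

lemma verts_prefix: "p @ q \<in> verts F \<Longrightarrow> p \<noteq> [] \<Longrightarrow> p \<in> verts F"
proof (induction p arbitrary: F)
  case (Cons i p)
  then show ?case by (cases "p = []") (auto simp: verts_Cons)
qed simp

lemma sub_snoc:
  "p \<in> verts F \<Longrightarrow> sub F (p @ [i]) =
     (if i < length (children (the (sub F p))) then Some (children (the (sub F p)) ! i) else None)"
proof (induction p arbitrary: F)
  case (Cons k p)
  then show ?case by (cases "p = []") (auto simp: verts_Cons sub_Cons)
qed simp

lemma verts_snoc_iff:
  "p @ [i] \<in> verts F \<longleftrightarrow>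
     p = [] \<and> i < length F \<or> p \<in> verts F \<and> i < length (children (the (sub F p)))"
proof (cases "p = []")
  case False
  then show ?thesis
    using verts_prefix[of p "[i]" F] sub_snoc[of p F i] by (auto simp: verts_def split: if_splits)
qed (simp add: verts_Cons)

lemma verts_snoc:
  "verts (G @ [Node a H]) = insert [length G] (verts G \<union> (#) (length G) ` verts H)"
proof -
  have "p \<in> verts (G @ [Node a H]) \<longleftrightarrow> p \<in> insert [length G] (verts G \<union> (#) (length G) ` verts H)" for p
    by (cases p) (auto simp: verts_Cons nth_append)
  then show ?thesis by blast
qed

lemma finite_verts [simp]: "finite (verts F)"
  by (induction F rule: pforest_induct) (simp_all add: verts_snoc)

lemma dec_snoc:
  "p \<in> verts G \<Longrightarrow> dec (G @ [Node a H]) p = dec G p"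
  "dec (G @ [Node a H]) [length G] = a"
  "p \<in> verts H \<Longrightarrow> dec (G @ [Node a H]) (length G # p) = dec H p"
  by (cases p; auto simp: dec_def sub_Cons verts_Cons nth_append)+

text \<open>Closed form of <<: at the depth where \<open>p\<close> ends, \<open>q\<close> passes
  through a left sibling of \<open>p\<close>, or through \<open>p\<close> itself and continues. No
  forest enters, so two paths compare alike in all forests that contain both.\<close>

fun plt :: "nat list \<Rightarrow> nat list \<Rightarrow> bool" where
  "plt [] q = False"
| "plt p [] = False"
| "plt (i # p) (j # q) = (if p = [] then j < i \<or> j = i \<and> q \<noteq> [] else i = j \<and> plt p q)"

lemma plt_Nil_right [simp]: "\<not> plt p []"
  by (cases p) auto

lemma plt_irrefl [simp]: "\<not> plt p p"
  by (induction p) auto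

lemma plt_trans: "plt p q \<Longrightarrow> plt q r \<Longrightarrow> plt p r"
proof (induction p q arbitrary: r rule: plt.induct)
  case (3 i p j q)
  then show ?case by (cases r) (auto split: if_splits)
qed auto

text \<open>Below \<open>r\<close> lie its proper prefixes and the right siblings of its prefixes,
  \<open>r\<close> included; they form a chain. This gives common lower bounds in connected
  components.\<close>

lemma plt_linear_below: "plt p r \<Longrightarrow> plt q r \<Longrightarrow> p = q \<or> plt p q \<or> plt q p"
proof (induction p r arbitrary: q rule: plt.induct)
  case (3 i p j r)
  then show ?case by (cases q) (auto split: if_splits)
qed auto

lemma plt_child: "p \<noteq> [] \<Longrightarrow> u \<noteq> [] \<Longrightarrow> plt p (p @ u)"
  by (induction p) auto

lemma plt_sibling: "plt (p @ [i]) (p @ [j]) \<longleftrightarrow> j < i"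
  by (induction p) auto

lemma pltE:
  assumes "plt v w"
  obtains p i j y where "v = p @ [i]" "w = p @ [j] @ y" "j \<le> i" "j < i \<or> y \<noteq> []"
proof -
  have "\<exists>p i j y. v = p @ [i] \<and> w = p @ [j] @ y \<and> j \<le> i \<and> (j < i \<or> y \<noteq> [])"
    using assms
  proof (induction v w rule: plt.induct)
    case (3 i p j q)
    show ?case
    proof (cases "p = []")
      case True
      then have "i # p = [] @ [i] \<and> j # q = [] @ [j] @ q \<and> j \<le> i \<and> (j < i \<or> q \<noteq> [])"
        using 3(2) by auto
      then show ?thesis by blast
    next
      case False
      then obtain p' i' j' y where "p = p' @ [i']" "q = p' @ [j'] @ y" "j' \<le> i'" "j' < i' \<or> y \<noteq> []"
        using 3 by auto
      then have "i # p = (i # p') @ [i'] \<and> j # q = (i # p') @ [j'] @ y \<and> j' \<le> i' \<and> (j' < i' \<or> y \<noteq> [])"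
        using 3(2) False by auto
      then show ?thesis by blast
    qed
  qed auto
  then show ?thesis using that by blast
qed

text \<open>\<open>Rrel\<close> with ancestors cut down to parents. These generators are the data of
  a parent map with sibling orders, so they transfer to \<open>ordgen\<close>.\<close>

definition pgen :: "'a pforest \<Rightarrow> nat list \<Rightarrow> nat list \<Rightarrow> bool" where
  "pgen F v w \<longleftrightarrow> v \<in> verts F \<and> w \<in> verts F \<and>
     ((\<exists>i. w = v @ [i]) \<or> (\<exists>p i j. v = p @ [i] \<and> w = p @ [j] \<and> j < i))"

lemma tranclp_pgen_descendant:
  "v \<noteq> [] \<Longrightarrow> u \<noteq> [] \<Longrightarrow> v @ u \<in> verts F \<Longrightarrow> (pgen F)\<^sup>+\<^sup>+ v (v @ u)"
proof (induction u rule: rev_induct)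
  case (snoc i u)
  have vu: "v @ u \<in> verts F" using verts_prefix[of "v @ u" "[i]"] snoc by simp
  then have g: "pgen F (v @ u) (v @ u @ [i])" using snoc(4) by (auto simp: pgen_def)
  show ?case
  proof (cases "u = []")
    case False
    then show ?thesis using snoc vu g by (meson tranclp.simps)
  qed (use g in auto)
qed simp

text \<open>The generators lie in the transitive relation \<open>plt\<close>. Conversely, a pair in
  \<open>plt\<close> is joined by at most one sibling step to the left, followed by steps from
  parent to child.\<close>

lemma ll_iff_plt: "ll F v w \<longleftrightarrow> v \<in> verts F \<and> w \<in> verts F \<and> plt v w"
  and ll_eq_tranclp_pgen: "ll F = (pgen F)\<^sup>+\<^sup>+"
proof -
  have R: "Rrel F v w \<Longrightarrow> v \<in> verts F \<and> w \<in> verts F \<and> plt v w" for v w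
    by (auto simp: Rrel_def anc_def plt_sibling intro: plt_child)
  have pR: "pgen F v w \<Longrightarrow> Rrel F v w" for v w
    by (auto simp: pgen_def Rrel_def anc_def)
  have "ll F v w \<Longrightarrow> v \<in> verts F \<and> w \<in> verts F \<and> plt v w" for v w
    unfolding ll_def
    by (induction rule: tranclp_induct) (use R in \<open>blast intro: plt_trans\<close>)+
  moreover have "(pgen F)\<^sup>+\<^sup>+ v w" if "v \<in> verts F" "w \<in> verts F" "plt v w" for v w
  proof -
    from that(3) obtain p i j y
      where *: "v = p @ [i]" "w = p @ [j] @ y" "j \<le> i" "j < i \<or> y \<noteq> []" by (rule pltE)
    have m: "p @ [j] \<in> verts F" using verts_prefix[of "p @ [j]" y F] that(2) * by simp
    have 1: "v = p @ [j] \<or> pgen F v (p @ [j])"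
      using * m that(1) by (auto simp: pgen_def)
    have 2: "p @ [j] = w \<or> (pgen F)\<^sup>+\<^sup>+ (p @ [j]) w"
      using tranclp_pgen_descendant[of "p @ [j]" y F] * that(2) by (cases "y = []") auto
    have "v \<noteq> w" using that(3) by auto
    with 1 2 show ?thesis by (metis tranclp.r_into_trancl tranclp_trans)
  qed
  moreover have "(pgen F)\<^sup>+\<^sup>+ v w \<Longrightarrow> ll F v w" for v w
    unfolding ll_def
  proof (induction rule: tranclp_induct)
    case (step y z)
    with pR show ?case by (meson tranclp.trancl_into_trancl)
  qed (use pR in blast)
  ultimately show "ll F v w \<longleftrightarrow> v \<in> verts F \<and> w \<in> verts F \<and> plt v w" "ll F = (pgen F)\<^sup>+\<^sup>+"
    by (blast, (intro ext iffI; blast))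
qed

definition arb_words :: "'a pforest \<Rightarrow> 'a list multiset" where
  "arb_words F = wext (verts F) (ll F) (dec F)"

lemma arb_words_Nil [simp]: "arb_words [] = {#[]#}"
  by (simp add: arb_words_def)

lemma arb_words_snoc:
  "arb_words (G @ [Node a H]) = image_mset (\<lambda>w. w @ [a]) (msh (arb_words G) (arb_words H))"
proof -
  let ?F = "G @ [Node a H]" and ?n = "length G"
  let ?B = "(#) ?n ` verts H"
  \<comment> \<open>The first index separates \<open>G\<close> from the last tree, all of whose
    paths begin with \<open>length G\<close>.\<close>
  have hd: "p \<noteq> [] \<and> hd p < ?n" if "p \<in> verts G" for p
    using that by (cases p) (auto simp: verts_Cons)
  have ne: "p \<noteq> []" if "p \<in> verts H" for p using that by auto
  have G: "wext (verts G) (ll ?F) (dec ?F) = arb_words G"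
    unfolding arb_words_def
    by (rule wext_bij_betw[OF bij_betw_id]) (auto simp: ll_iff_plt verts_snoc dec_snoc)
  have "bij_betw ((#) ?n) (verts H) ?B" by (simp add: bij_betw_def)
  then have H: "wext ?B (ll ?F) (dec ?F) = arb_words H"
    unfolding arb_words_def
    by (intro wext_bij_betw[symmetric])
       (use ne in \<open>auto simp: ll_iff_plt verts_snoc dec_snoc verts_Cons split: if_splits\<close>)
  have "wext (insert [?n] (verts G \<union> ?B)) (ll ?F) (dec ?F) =
      image_mset (\<lambda>w. w @ [dec ?F [?n]]) (wext (verts G \<union> ?B) (ll ?F) (dec ?F))"
  proof (rule wext_insert_min)
    show "[?n] \<notin> verts G \<union> ?B" using hd by force
    show "ll ?F [?n] x" if "x \<in> verts G \<union> ?B" for x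
      using that hd[of x] by (cases x) (auto simp: ll_iff_plt verts_snoc)
    show "\<not> ll ?F x [?n]" if "x \<in> verts G \<union> ?B" for x
      using that hd[of x] by (cases x) (auto simp: ll_iff_plt split: if_splits)
  qed (auto simp: ll_iff_plt)
  also have "wext (verts G \<union> ?B) (ll ?F) (dec ?F) =
      msh (wext (verts G) (ll ?F) (dec ?F)) (wext ?B (ll ?F) (dec ?F))"
  proof (rule wext_Un)
    show "verts G \<inter> ?B = {}" using hd by force
    show "\<not> ll ?F x y \<and> \<not> ll ?F y x" if "x \<in> verts G" "y \<in> ?B" for x y
      using that hd[of x] by (cases x) (auto simp: ll_iff_plt split: if_splits)
  qed (auto simp: ll_iff_plt)
  finally show ?thesis
    by (simp add: arb_words_def[of ?F] verts_snoc dec_snoc G H)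
qed

section \<open>Planar forests unfolded from a planar structure\<close>

text \<open>Counterpart of \<open>pgen\<close> on abstract vertices; a later list entry is further
  right and therefore lower.\<close>

definition ordgen :: "'v set \<Rightarrow> ('v \<Rightarrow> 'v option) \<Rightarrow> ('v option \<Rightarrow> 'v list) \<Rightarrow> 'v \<Rightarrow> 'v \<Rightarrow> bool" where
  "ordgen V par ord x y \<longleftrightarrow> x \<in> V \<and> y \<in> V \<and>
     (par y = Some x \<or> (\<exists>z i j. i < length (ord z) \<and> j < i \<and> x = ord z ! i \<and> y = ord z ! j))"

lemma finite_child_rel: "finite V \<Longrightarrow> nforest V par \<Longrightarrow> finite (child_rel V par)"
  by (rule finite_subset[of _ "V \<times> V"]) (auto simp: child_rel_def nforest_def)

text \<open>\<open>tree\<close> is given by its unfolding equation instead of a recursion, since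
  both \<open>ind_tree\<close> on paths and the fuel-driven \<open>build\<close> satisfy it. Induced
  forests and \<open>planar_of\<close> are the two instances.\<close>

locale planar_unfolding =
  fixes V :: "'v set" and par ord and \<phi> :: "'v \<Rightarrow> 'a" and tree :: "'v \<Rightarrow> 'a ptree"
  assumes nforest: "nforest V par"
    and planar: "planar_structure V par ord"
    and tree: "\<And>v. v \<in> V \<Longrightarrow> tree v = Node (\<phi> v) (map tree (ord (Some v)))"
begin

definition forest :: "'a pforest" where
  "forest = map tree (ord None)"

text \<open>The renaming from paths to original vertices. \<open>None\<close> acts as a virtual
  parent of the roots, so that roots and children are followed alike.\<close>

definition follow :: "nat list \<Rightarrow> 'v option" where
  "follow p = foldl (\<lambda>x i. Some (ord x ! i)) None p"

lemma follow_simps [simp]: "follow [] = None" "follow [i] = Some (ord None ! i)" "follow (p @ [i]) = Some (ord (follow p) ! i)"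
  by (simp_all add: follow_def)

lemma ord_planar:
  assumes "x \<in> insert None (Some ` V)"
  shows "distinct (ord x)" "set (ord x) = {v \<in> V. par v = x}"
proof -
  have "x = None \<or> (\<exists>u\<in>V. x = Some u)" using assms by auto
  from planar[unfolded planar_structure_def, THEN conjunct1, THEN spec, THEN mp, OF this]
  show "distinct (ord x)" "set (ord x) = {v \<in> V. par v = x}" by simp_all
qed

lemma ord_outside: "x \<notin> insert None (Some ` V) \<Longrightarrow> ord x = []"
proof -
  assume "x \<notin> insert None (Some ` V)"
  then have "\<not> (x = None \<or> (\<exists>u\<in>V. x = Some u))" by auto
  from planar[unfolded planar_structure_def, THEN conjunct2, THEN spec, THEN mp, OF this]
  show ?thesis .
qed

lemma sub_forest:
  "p \<in> verts forest \<Longrightarrow> \<exists>v\<in>V. follow p = Some v \<and> sub forest p = Some (tree v)"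
proof (induction p rule: rev_induct)
  case (snoc i p)
  show ?case
  proof (cases "p = []")
    case True
    then have "i < length (ord None)" using snoc(2) by (simp add: verts_Cons forest_def)
    then show ?thesis
      using True nth_mem[of i "ord None"] ord_planar(2)[of None] by (auto simp: forest_def)
  next
    case False
    then have p: "p \<in> verts forest" using verts_prefix[of p "[i]"] snoc(2) by simp
    then obtain v where v: "v \<in> V" "follow p = Some v" "sub forest p = Some (tree v)"
      using snoc by blast
    then have c: "children (the (sub forest p)) = map tree (ord (Some v))"
      by (simp add: tree)
    then have i: "i < length (ord (Some v))" using snoc(2) False by (simp add: verts_snoc_iff)
    with v c show ?thesis
      using sub_snoc[OF p, of i] nth_mem[OF i] ord_planar(2)[of "Some v"] by auto
  qed
qed simp

lemma follow_dom: "p = [] \<or> p \<in> verts forest \<Longrightarrow> follow p \<in> insert None (Some ` V)"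
  using sub_forest[of p] by auto

lemma snoc_in_verts_forest:
  assumes "p = [] \<or> p \<in> verts forest"
  shows "p @ [i] \<in> verts forest \<longleftrightarrow> i < length (ord (follow p))"
proof (cases "p = []")
  case True
  then show ?thesis by (simp add: verts_Cons forest_def)
next
  case False
  then have "p \<in> verts forest" using assms by simp
  then obtain v where "v \<in> V" "follow p = Some v" "sub forest p = Some (tree v)"
    using sub_forest by blast
  with False \<open>p \<in> verts forest\<close> show ?thesis by (simp add: verts_snoc_iff tree)
qed

lemma vert_cases:
  assumes "p \<in> verts forest"
  obtains q i where "p = q @ [i]" "q = [] \<or> q \<in> verts forest" "i < length (ord (follow q))"
proof (cases p rule: rev_cases)
  case (snoc q i)
  moreover from this assms have "q = [] \<or> q \<in> verts forest"
    using verts_prefix[of q "[i]"] by auto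
  ultimately show ?thesis using that snoc_in_verts_forest assms by blast
qed (use assms in simp)

lemma par_follow_snoc:
  assumes "q = [] \<or> q \<in> verts forest" "i < length (ord (follow q))"
  shows "par (ord (follow q) ! i) = follow q"
  using nth_mem[OF assms(2)] ord_planar(2)[OF follow_dom[OF assms(1)]] by simp

text \<open>\<open>par\<close> recovers the parent from the vertex reached, so the induction applies
  to the shortened paths; distinctness of the sibling list then fixes the last index.\<close>

lemma follow_inj:
  assumes "p = [] \<or> p \<in> verts forest" "q = [] \<or> q \<in> verts forest" "follow p = follow q"
  shows "p = q"
  using assms
proof (induction p arbitrary: q rule: rev_induct)
  case Nil
  then show ?case using sub_forest by fastforce
next
  case (snoc i p)
  from snoc.prems(1) have pi: "p @ [i] \<in> verts forest" by simp
  then have p: "p = [] \<or> p \<in> verts forest" "i < length (ord (follow p))"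
    by (auto elim: vert_cases)
  have "q \<noteq> []" using snoc.prems by auto
  then obtain r j where q: "q = r @ [j]" "r = [] \<or> r \<in> verts forest" "j < length (ord (follow r))"
    using snoc.prems(2) vert_cases by blast
  have e: "ord (follow p) ! i = ord (follow r) ! j" using snoc.prems(3) q by simp
  then have "follow p = follow r"
    using par_follow_snoc[OF p] par_follow_snoc[OF q(2,3)] by simp
  moreover from this have "p = r" by (rule snoc.IH[OF p(1) q(2)])
  ultimately show ?case
    using e p q ord_planar(1)[OF follow_dom[OF p(1)]] by (simp add: nth_eq_iff_index_eq)
qed

lemma follow_surj:
  assumes "v \<in> V"
  shows "\<exists>p\<in>verts forest. follow p = Some v"
proof -
  \<comment> \<open>In the converse relation the parent precedes the child, so the induction starts
    at the roots.\<close>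
  have "wf ((child_rel V par)\<inverse>)"
    using nforest by (intro finite_acyclic_wf_converse finite_child_rel) (auto simp: nforest_def)
  then show ?thesis using assms
  proof (induction v rule: wf_induct_rule)
    case (less v)
    have "\<exists>q. (q = [] \<or> q \<in> verts forest) \<and> follow q = par v"
    proof (cases "par v")
      case None
      then show ?thesis by (intro exI[of _ "[]"]) simp
    next
      case (Some u)
      then have "(u, v) \<in> (child_rel V par)\<inverse>" "u \<in> V"
        using less(2) nforest by (auto simp: child_rel_def nforest_def)
      then show ?thesis using less(1) Some by metis
    qed
    then obtain q where q: "q = [] \<or> q \<in> verts forest" "follow q = par v" by blast
    then have "v \<in> set (ord (follow q))" using ord_planar(2)[OF follow_dom[OF q(1)]] less(2) by simp
    then obtain i where "i < length (ord (follow q))" "ord (follow q) ! i = v"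
      by (auto simp: in_set_conv_nth)
    then show ?case using q snoc_in_verts_forest by (intro bexI[of _ "q @ [i]"]) auto
  qed
qed

lemma bij_betw_follow: "bij_betw (\<lambda>p. the (follow p)) (verts forest) V"
proof -
  have "inj_on (\<lambda>p. the (follow p)) (verts forest)"
    by (rule inj_onI) (metis follow_inj option.sel sub_forest)
  moreover have "(\<lambda>p. the (follow p)) ` verts forest = V"
  proof (intro equalityI subsetI)
    fix v assume "v \<in> V"
    then obtain p where "p \<in> verts forest" "follow p = Some v" using follow_surj by blast
    then show "v \<in> (\<lambda>p. the (follow p)) ` verts forest" by (intro image_eqI[of _ _ p]) auto
  next
    fix v assume "v \<in> (\<lambda>p. the (follow p)) ` verts forest"
    then obtain p where "p \<in> verts forest" "v = the (follow p)" by blast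
    then show "v \<in> V" using sub_forest[of p] by auto
  qed
  ultimately show ?thesis by (simp add: bij_betw_def)
qed

lemma dec_forest: "p \<in> verts forest \<Longrightarrow> dec forest p = \<phi> (the (follow p))"
  using sub_forest[of p] by (auto simp: dec_def tree)

lemma pgen_iff_ordgen:
  assumes p: "p \<in> verts forest" and q: "q \<in> verts forest"
  shows "pgen forest p q \<longleftrightarrow> ordgen V par ord (the (follow p)) (the (follow q))"
proof -
  obtain p' i where p': "p = p' @ [i]" "p' = [] \<or> p' \<in> verts forest" "i < length (ord (follow p'))"
    using p by (rule vert_cases)
  obtain q' j where q': "q = q' @ [j]" "q' = [] \<or> q' \<in> verts forest" "j < length (ord (follow q'))"
    using q by (rule vert_cases)
  note pp = par_follow_snoc[OF p'(2,3)] and pq = par_follow_snoc[OF q'(2,3)]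
  have V: "the (follow p) \<in> V" "the (follow q) \<in> V" using sub_forest p q by force+
  have fp: "Some (the (follow p)) = follow p" using p' by simp
  have "(\<exists>i. q = p @ [i]) \<longleftrightarrow> q' = p" using q' by auto
  also have "\<dots> \<longleftrightarrow> follow q' = follow p" using follow_inj[OF q'(2)] p by blast
  finally have 1: "(\<exists>i. q = p @ [i]) \<longleftrightarrow> par (the (follow q)) = Some (the (follow p))"
    using q' pq fp by simp
  have "(\<exists>z k l. k < length (ord z) \<and> l < k \<and> the (follow p) = ord z ! k \<and> the (follow q) = ord z ! l)
      \<longleftrightarrow> p' = q' \<and> j < i" (is "?L \<longleftrightarrow> ?R")
  proof
    assume ?L
    then obtain z k l where z: "k < length (ord z)" "l < k"
      "ord (follow p') ! i = ord z ! k" "ord (follow q') ! j = ord z ! l"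
      using p' q' by auto
    \<comment> \<open>\<open>ord\<close> is \<open>[]\<close> away from \<open>None\<close> and the
      vertices; a nonempty list therefore makes \<open>z\<close> the common parent of its
      entries.\<close>
    then have "ord z \<noteq> []" by auto
    then have zd: "z \<in> insert None (Some ` V)" using ord_outside by blast
    have "follow p' = z" "follow q' = z"
      using pp pq z ord_planar(2)[OF zd] nth_mem[of k "ord z"] nth_mem[of l "ord z"] by auto
    moreover from this have "p' = q'" using follow_inj[OF p'(2) q'(2)] by simp
    ultimately show ?R
      using z p'(3) q'(3) ord_planar(1)[OF zd] by (auto simp: nth_eq_iff_index_eq)
  next
    assume ?R
    with p' q' show ?L by auto
  qed
  with 1 V p q p' q' show ?thesis by (auto simp: pgen_def ordgen_def)
qed

lemma arb_words_forest: "arb_words forest = wext V (ordgen V par ord) \<phi>"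
proof -
  have "lext (verts forest) (ll forest) = lext (verts forest) (pgen forest)"
    unfolding ll_eq_tranclp_pgen by (rule lext_tranclp) (simp add: pgen_def)
  then have "arb_words forest = wext (verts forest) (pgen forest) (dec forest)"
    by (simp add: arb_words_def wext_def)
  also have "\<dots> = wext V (ordgen V par ord) \<phi>"
    by (rule wext_bij_betw[OF bij_betw_follow]) (simp_all add: pgen_iff_ordgen dec_forest)
  finally show ?thesis .
qed

end

section \<open>Induced forests\<close>

lemma lext_mono:
  assumes "\<And>x y. x \<in> A \<Longrightarrow> y \<in> A \<Longrightarrow> S x y \<Longrightarrow> R x y"
  shows "lext A R \<subseteq> lext A S"
proof
  fix vs assume vs: "vs \<in> lext A R"
  then have "R (vs ! i) (vs ! j)" if "i < length vs" "j < length vs" "S (vs ! i) (vs ! j)" for i j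
    using assms that nth_mem set_lext by metis
  with vs show "vs \<in> lext A S" by (simp add: lext_def)
qed

lemma snoc_less_iff: "p @ [i] < p @ [j] \<longleftrightarrow> i < j" for i :: "'b :: linorder"
  by (induction p) (auto simp: Cons_less_Cons)

lemma plt_append_iff: "plt (p @ [i]) (p @ j # y) \<longleftrightarrow> j < i \<or> j = i \<and> y \<noteq> []"
  by (induction p) auto

text \<open>The induced forest unfolds \<open>W\<close> with siblings in lexicographic order, so its
  words are governed by \<open>ordgen\<close>. Convexity factors each relation of << inside
  \<open>W\<close> into these generators. As the roots of \<open>W\<close> are siblings in
  \<open>F\<close>, the order imposed on them already holds in \<open>F\<close>.\<close>

lemma arb_words_restr:
  assumes WF: "W \<subseteq> verts F"
    and conv: "\<And>x y z. x \<in> W \<Longrightarrow> z \<in> W \<Longrightarrow> ll F x y \<Longrightarrow> ll F y z \<Longrightarrow> y \<in> W"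
    and roots: "\<And>x y. x \<in> W \<Longrightarrow> y \<in> W \<Longrightarrow> butlast x \<notin> W \<Longrightarrow> butlast y \<notin> W \<Longrightarrow> butlast x = butlast y"
  shows "arb_words (restr F W) = wext W (ll F) (dec F)"
proof -
  define par where "par v = (if butlast v \<in> W then Some (butlast v) else None)" for v
  define ord where "ord z = sorted_list_of_set {v \<in> W. par v = z}" for z
  define tree where "tree v = ind_tree W v (the (sub F v))" for v
  have fin: "finite W" using WF finite_verts by (rule finite_subset)
  have ne: "v \<noteq> []" if "v \<in> W" for v using that WF by auto
  have set_ord: "set (ord z) = {v \<in> W. par v = z}" for z using fin by (simp add: ord_def)
  have "child_rel W par \<subseteq> (measure length)\<inverse>"
    using ne by (auto simp: child_rel_def par_def split: if_splits)
  then have "acyclic (child_rel W par)"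
    using wf_acyclic[OF wf_measure] acyclic_subset acyclic_converse by metis
  then have nf: "nforest W par" using fin by (auto simp: nforest_def par_def split: if_splits)
  \<comment> \<open>Matches the sorted siblings with the list over which \<open>ind_tree\<close>
    maps, as the unfolding equation demands.\<close>
  have "ord (Some v) = map (\<lambda>i. v @ [i])
      (filter (\<lambda>i. v @ [i] \<in> W) [0..<length (children (the (sub F v)))])" (is "_ = ?xs")
    if "v \<in> W" for v
  proof -
    have v: "v \<in> verts F" using that WF by auto
    have "w \<in> set ?xs \<longleftrightarrow> w \<in> W \<and> par w = Some v" for w
    proof
      assume w: "w \<in> W \<and> par w = Some v"
      then have "butlast w = v" "w \<noteq> []" using ne by (auto simp: par_def split: if_splits)
      then have e: "w = v @ [last w]" by (metis append_butlast_last_id)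
      then have "v @ [last w] \<in> verts F" using w WF by auto
      then have "last w < length (children (the (sub F v)))"
        using ne[OF that] by (simp add: verts_snoc_iff)
      with e w show "w \<in> set ?xs" by auto
    qed (use that in \<open>auto simp: par_def\<close>)
    then have "set ?xs = {w \<in> W. par w = Some v}" by blast
    moreover have "distinct ?xs" by (simp add: distinct_map inj_on_def)
    moreover have "v @ [i] \<le> v @ [j] \<longleftrightarrow> i \<le> j" for i j :: nat
      using snoc_less_iff[of v j i] by (simp flip: not_less)
    then have "sorted ?xs"
      by (simp add: sorted_map sorted_wrt_filter)
    ultimately show ?thesis
      unfolding ord_def using sorted_list_of_set.idem_if_sorted_distinct[of ?xs] by simp
  qed
  note ord_Some = this
  have tree: "tree v = Node (dec F v) (map tree (ord (Some v)))" if "v \<in> W" for v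
  proof -
    have v: "v \<in> verts F" using that WF by auto
    then obtain t' where "sub F v = Some t'" by (auto simp: verts_def)
    then obtain a ts where t: "sub F v = Some (Node a ts)" by (cases t') auto
    show ?thesis
      using sub_snoc[OF v] by (auto simp: tree_def t dec_def ord_Some[OF that])
  qed
  have ps: "planar_structure W par ord"
    using fin unfolding planar_structure_def
    by (auto simp: set_ord) (auto simp: ord_def par_def split: if_splits)
  interpret planar_unfolding W par ord "dec F" tree
    by unfold_locales (use nf ps tree in auto)
  have "{v \<in> W. v \<in> verts F \<and> butlast v \<notin> W} = {v \<in> W. par v = None}"
    using WF by (auto simp: par_def)
  then have forest: "restr F W = forest"
    unfolding restr_def forest_def by (simp add: ord_def tree_def[abs_def])
  \<comment> \<open>Convexity keeps every vertex between \<open>v\<close> and \<open>v @ u\<close>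
    in \<open>W\<close>, so parent-child steps connect them.\<close>
  have descend: "(ordgen W par ord)\<^sup>+\<^sup>+ v (v @ u)" if "v \<in> W" "v @ u \<in> W" "u \<noteq> []" for v u
    using that
  proof (induction u rule: rev_induct)
    case (snoc i u)
    have "v @ u \<in> verts F"
      using verts_prefix[of "v @ u" "[i]" F] snoc.prems WF ne[of v] by auto
    then have vu: "v @ u \<in> W"
      using conv[of v "v @ u @ [i]" "v @ u"] snoc.prems WF ne[of v] plt_child[of v u]
        plt_child[of "v @ u" "[i]"]
      by (cases "u = []") (auto simp: ll_iff_plt)
    then have g: "ordgen W par ord (v @ u) (v @ u @ [i])"
      using snoc.prems by (auto simp: ordgen_def par_def butlast_append)
    show ?case
    proof (cases "u = []")
      case False
      then show ?thesis using snoc.IH snoc.prems vu g by (meson tranclp.trancl_into_trancl)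
    qed (use g in auto)
  qed simp
  have "lext W (ordgen W par ord) \<subseteq> lext W (ll F)"
  proof (rule lext_mono_tranclp)
    fix x y assume xy: "x \<in> W" "y \<in> W" "ll F x y"
    then have "plt x y" by (simp add: ll_iff_plt)
    then obtain p i j u where e: "x = p @ [i]" "y = p @ [j] @ u" "j \<le> i" "j < i \<or> u \<noteq> []"
      by (rule pltE)
    \<comment> \<open>\<open>?m\<close> is the left sibling of \<open>x\<close>, or \<open>x\<close>
      itself, through which the path to \<open>y\<close> runs. Where it differs from
      \<open>x\<close> and \<open>y\<close>, convexity places it in \<open>W\<close>.\<close>
    let ?m = "p @ [j]"
    have "?m \<in> verts F" using verts_prefix[of ?m u F] xy WF e by auto
    then have m: "?m \<in> W"
      using conv[OF xy(1,2), of ?m] xy e WF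
      by (cases "u = []"; cases "j = i") (auto simp: ll_iff_plt plt_append_iff plt_sibling)
    have 1: "ordgen W par ord x ?m" if "j < i"
    proof -
      have "x \<in> set (ord (par x))" "?m \<in> set (ord (par x))"
        using xy m e by (auto simp: set_ord par_def)
      then obtain k l where kl: "k < length (ord (par x))" "ord (par x) ! k = x"
        "l < length (ord (par x))" "ord (par x) ! l = ?m"
        by (auto simp: in_set_conv_nth)
      have "\<not> k \<le> l"
      proof
        assume "k \<le> l"
        then have "x \<le> ?m"
          using sorted_nth_mono[of "ord (par x)" k l] kl by (simp add: ord_def)
        then show False using that snoc_less_iff[of p j i] e by auto
      qed
      then have "\<exists>z k l. k < length (ord z) \<and> l < k \<and> x = ord z ! k \<and> ?m = ord z ! l"
        using kl not_le by metis
      then show ?thesis using xy m by (simp add: ordgen_def)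
    qed
    have 2: "(ordgen W par ord)\<^sup>+\<^sup>+ ?m y" if "u \<noteq> []"
      using descend[of ?m u] m xy e that by simp
    show "(ordgen W par ord)\<^sup>+\<^sup>+ x y"
      using 1 2 e by (cases "u = []"; cases "j = i") (auto intro: tranclp_into_tranclp2)
  qed (simp add: ordgen_def)
  moreover have "lext W (ll F) \<subseteq> lext W (ordgen W par ord)"
  proof (rule lext_mono)
    fix x y assume xy: "x \<in> W" "y \<in> W" "ordgen W par ord x y"
    have ex: "x = butlast x @ [last x]" "y = butlast y @ [last y]" using xy ne by simp_all
    have "plt x y"
    proof (cases "par y = Some x")
      case True
      then have "butlast y = x" by (simp add: par_def split: if_splits)
      then have "y = x @ [last y]" using ex by simp
      then show ?thesis using plt_child[of x "[last y]"] ne[OF xy(1)] by simp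
    next
      case False
      then obtain z k l where z: "k < length (ord z)" "l < k" "x = ord z ! k" "y = ord z ! l"
        using xy by (auto simp: ordgen_def)
      have "distinct (ord z)" "sorted (ord z)" by (simp_all add: ord_def)
      then have lt: "y < x"
        using z sorted_nth_mono[of "ord z" l k] nth_eq_iff_index_eq[of "ord z" l k]
        by (simp add: order_less_le)
      have "par x = z" "par y = z"
        using z nth_mem[of k "ord z"] nth_mem[of l "ord z"] by (auto simp: set_ord)
      \<comment> \<open>If \<open>z\<close> is a vertex, it is the parent of both; if
        \<open>z\<close> is \<open>None\<close>, both are roots of \<open>W\<close> and
        \<open>roots\<close> applies.\<close>
      then have "butlast x = butlast y"
        using roots[of x y] xy by (auto simp: par_def split: if_splits)
      then show ?thesis using ex lt snoc_less_iff plt_sibling by metis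
    qed
    then show "ll F x y" using xy WF by (auto simp: ll_iff_plt)
  qed
  ultimately have "lext W (ordgen W par ord) = lext W (ll F)" by blast
  then show ?thesis by (simp add: forest arb_words_forest wext_def)
qed

section \<open>Planar arborification is a Hopf morphism\<close>

lemma arb_ll_basis_eq: "arb_ll_basis F = msv (arb_words F)"
  by (simp add: arb_ll_basis_def arb_words_def wext_def msv_mset_set) (simp add: lext_def)

lemma arb_ll_vsingle [simp]: "arb_ll (vsingle F) = msv (arb_words F)"
  by (simp add: arb_ll_def arb_ll_basis_eq)

section \<open>Multiplicativity\<close>

lemma sum_mset_image_msh:
  "(\<Sum>x\<in>#M. image_mset f (msh (g x) N)) = image_mset f (msh (\<Sum>x\<in>#M. g x) N)"
  by (induction M) simp_all

text \<open>Both sides obey one recursion: the last tree of a shuffle, hence the last letter of its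
  words, comes from \<open>F\<close> or from \<open>G\<close>. Commutativity and associativity of
  \<open>msh\<close> move the words of \<open>H\<close> and \<open>J\<close> into place.\<close>

lemma sum_arb_words_shuffle:
  "(\<Sum>K\<in>#shuffle_ms F G. arb_words K) = msh (arb_words F) (arb_words G)"
proof (induction "length F + length G" arbitrary: F G rule: less_induct)
  case less
  show ?case
  proof (cases F rule: rev_cases)
    case F: (snoc F' s)
    show ?thesis
    proof (cases G rule: rev_cases)
      case G: (snoc G' t)
      obtain a H where s: "s = Node a H" by (cases s)
      obtain b J where t: "t = Node b J" by (cases t)
      let ?a = "image_mset (\<lambda>w. w @ [a])" and ?b = "image_mset (\<lambda>w. w @ [b])"
      have 1: "(\<Sum>K\<in>#shuffle_ms F' G. arb_words K) = msh (arb_words F') (arb_words G)"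
        and 2: "(\<Sum>K\<in>#shuffle_ms F G'. arb_words K) = msh (arb_words F) (arb_words G')"
        by (rule less; simp add: F G)+
      have "(\<Sum>K\<in>#shuffle_ms F G. arb_words K) =
          (\<Sum>K\<in>#shuffle_ms F' G. ?a (msh (arb_words K) (arb_words H))) +
          (\<Sum>K\<in>#shuffle_ms F G'. ?b (msh (arb_words K) (arb_words J)))"
        by (simp add: F G s t shuffle_ms_snoc image_mset.compositionality o_def arb_words_snoc)
      also have "\<dots> = ?a (msh (msh (arb_words F') (arb_words H)) (arb_words G)) +
          ?b (msh (arb_words F) (msh (arb_words G') (arb_words J)))"
        unfolding sum_mset_image_msh 1 2 by (metis msh_assoc msh_commute)
      also have "\<dots> = msh (arb_words F) (arb_words G)"
        by (simp add: F G s t arb_words_snoc msh_snoc)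
      finally show ?thesis .
    qed simp
  qed simp
qed

lemma arb_ll_shmult: "arb_ll (shmult u v) = shmult (arb_ll u) (arb_ll v)"
  unfolding arb_ll_def
  by (rule lin_shmult)
     (simp add: lin_msv arb_ll_basis_eq shmult_msv flip: sum_arb_words_shuffle msv_sum_mset)

lemma arb_ll_add: "arb_ll (u + v) = arb_ll u + arb_ll v"
  and arb_ll_smult: "arb_ll (smult c u) = smult c (arb_ll u)"
  and arb_ll_zero [simp]: "arb_ll 0 = 0"
  by (simp_all add: arb_ll_def lin_add lin_smult)

lemma length_arb_words: "w \<in># arb_words F \<Longrightarrow> length w = nverts F"
  by (auto simp: arb_words_def wext_def nverts_def) (metis distinct_card distinct_lext set_lext)

lemma lookup_vsingle: "Poly_Mapping.lookup (vsingle x) y = (if x = y then 1 else 0)"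
  by (simp add: vsingle_def lookup_single when_def)

lemma counit_arb_ll: "counit (arb_ll u) = counit u"
proof (induction u rule: vector_induct)
  case (vsingle F)
  show ?case
  proof (cases F rule: rev_cases)
    case Nil
    then show ?thesis by (simp add: counit_def lookup_vsingle)
  next
    case (snoc G t)
    then have "[] \<notin># arb_words F" by (cases t) (auto simp: arb_words_snoc)
    with snoc show ?thesis by (simp add: counit_def lookup_vsingle not_in_iff)
  qed
qed (simp_all add: counit_def arb_ll_add arb_ll_smult lookup_add)

section \<open>Surjectivity\<close>

lemma arb_words_ladder: "\<exists>F. arb_words F = {#w#}"
proof (induction w rule: rev_induct)
  case Nil
  show ?case by (intro exI[of _ "[]"]) simp
next
  case (snoc a w)
  then obtain H where "arb_words H = {#w#}" by blast
  then show ?case using arb_words_snoc[of "[]" a H] by auto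
qed

lemma surj_arb_ll: "surj (arb_ll :: ('a pforest \<Rightarrow>\<^sub>0 'k::field) \<Rightarrow> _)"
proof -
  have "\<exists>v :: 'a pforest \<Rightarrow>\<^sub>0 'k. u = arb_ll v" for u :: "'a list \<Rightarrow>\<^sub>0 'k"
  proof (induction u rule: vector_induct)
    case (vsingle w)
    obtain F where "arb_words F = {#w#}" using arb_words_ladder by blast
    then show ?case by (intro exI[of _ "vsingle F"]) simp
  next
    case zero
    show ?case by (intro exI[of _ 0]) simp
  next
    case (add u v)
    then show ?case by (metis arb_ll_add)
  next
    case (smult c u)
    then show ?case by (metis arb_ll_smult)
  qed
  then show ?thesis by (simp add: surj_def)
qed

section \<open>Deconcatenation of linear extensions\<close>

lemma deconc_wext:
  assumes fin: "finite A" and irr: "\<And>x. x \<in> A \<Longrightarrow> \<not> R x x"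
  shows "lin deconc (msv (wext A R \<phi>)) =
    (\<Sum>B\<in>{B. B \<subseteq> A \<and> (\<forall>x\<in>A - B. \<forall>y\<in>B. \<not> R x y)}.
       tensor (msv (wext (A - B) R \<phi>)) (msv (wext B R \<phi>)))"
proof -
  let ?D = "{B. B \<subseteq> A \<and> (\<forall>x\<in>A - B. \<forall>y\<in>B. \<not> R x y)}"
  let ?g = "\<lambda>(us, vs). vsingle (map \<phi> us, map \<phi> vs)"
  have finD: "finite ?D" using fin by (intro finite_subset[of ?D "Pow A"]) auto
  note app = lext_append_iff[of A R, OF irr]
  have split: "take i vs \<in> lext (A - set (drop i vs)) R \<and> drop i vs \<in> lext (set (drop i vs)) R
      \<and> set (drop i vs) \<in> ?D" if "vs \<in> lext A R" for vs i
    using app[of "take i vs" "drop i vs"] that by simp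
  have join: "us @ vs \<in> lext A R" if "B \<in> ?D" "us \<in> lext (A - B) R" "vs \<in> lext B R" for B us vs
    using app[of us vs] that set_lext[OF that(3)] by auto
  have "lin deconc (msv (wext A R \<phi>)) =
      (\<Sum>vs\<in>lext A R. \<Sum>i\<in>{0..length vs}. ?g (take i vs, drop i vs))"
    by (simp add: lin_msv wext_def image_mset.compositionality o_def deconc_def take_map drop_map
        sum_unfold_sum_mset)
  also have "\<dots> = (\<Sum>(vs, i)\<in>Sigma (lext A R) (\<lambda>vs. {0..length vs}). ?g (take i vs, drop i vs))"
    by (rule sum.Sigma) auto
  also have "\<dots> = (\<Sum>(B, p)\<in>Sigma ?D (\<lambda>B. lext (A - B) R \<times> lext B R). ?g p)"
  \<comment> \<open>\<open>B\<close> collects the entries after the cut, and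
    \<open>length us\<close> recovers the position of the cut.\<close>
  proof (rule sum.reindex_bij_witness[of _ "\<lambda>(B, us, vs). (us @ vs, length us)"
        "\<lambda>(vs, i). (set (drop i vs), take i vs, drop i vs)"], goal_cases)
    case (2 a) then show ?case using split by auto
  next
    case (4 b) then show ?case using join by auto
  next
    case (3 b) then show ?case by (auto dest: set_lext)
  qed auto
  also have "\<dots> = (\<Sum>B\<in>?D. \<Sum>p\<in>lext (A - B) R \<times> lext B R. ?g p)"
    by (rule sum.Sigma[symmetric]) (use finD in auto)
  also have "\<dots> = (\<Sum>B\<in>?D. tensor (msv (wext (A - B) R \<phi>)) (msv (wext B R \<phi>)))"
    by (simp add: tensor_msv wext_def image_mset.compositionality o_def
        flip: sum.cartesian_product sum_unfold_sum_mset)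
  finally show ?thesis .
qed

section \<open>Connected components for <<\<close>

lemma comprel_tranclp_sym: "(comprel F V)\<^sup>+\<^sup>+ x y \<Longrightarrow> (comprel F V)\<^sup>+\<^sup>+ y x"
proof (induction rule: tranclp_induct)
  case (base y)
  then show ?case by (auto simp: comprel_def)
next
  case (step y z)
  then have "comprel F V z y" by (auto simp: comprel_def)
  then show ?case using step.IH by (rule tranclp_into_tranclp2)
qed

definition linked :: "'a pforest \<Rightarrow> nat list set \<Rightarrow> nat list \<Rightarrow> nat list \<Rightarrow> bool" where
  "linked F V x y \<longleftrightarrow> x \<in> V \<and> y \<in> V \<and> (x = y \<or> (comprel F V)\<^sup>+\<^sup>+ x y)"

lemma linked_sym: "linked F V x y \<Longrightarrow> linked F V y x"
  using comprel_tranclp_sym unfolding linked_def by metis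

lemma linked_trans: "linked F V x y \<Longrightarrow> linked F V y z \<Longrightarrow> linked F V x z"
  unfolding linked_def by (metis tranclp_trans)

lemma comps_eq_linked: "comps F V = (\<lambda>x. {y. linked F V x y}) ` V"
  by (auto simp: comps_def linked_def)

lemma linked_if_comparable: "x \<in> V \<Longrightarrow> y \<in> V \<Longrightarrow> ll F x y \<or> ll F y x \<Longrightarrow> linked F V x y"
  by (auto simp: linked_def comprel_def)

lemma comps_linked_iff:
  assumes "C \<in> comps F V" "x \<in> C"
  shows "C = {y. linked F V x y}"
  using assms linked_sym linked_trans unfolding comps_eq_linked by blast

lemma Union_comps: "\<Union>(comps F V) = V"
  unfolding comps_eq_linked by (auto simp: linked_def)

text \<open>Induction along a zigzag. A step up keeps \<open>m\<close>. On a step down from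
  \<open>y\<close> to \<open>z\<close>, both \<open>m\<close> and \<open>z\<close> lie weakly below
  \<open>y\<close>, hence are comparable, and the lower of the two serves.\<close>

lemma linked_lower_bound:
  assumes "linked F V x y"
  shows "\<exists>m\<in>V. (m = x \<or> ll F m x) \<and> (m = y \<or> ll F m y)"
proof -
  have "(comprel F V)\<^sup>+\<^sup>+ x y \<Longrightarrow> \<exists>m\<in>V. (m = x \<or> ll F m x) \<and> (m = y \<or> ll F m y)"
  proof (induction rule: tranclp_induct)
    case (base y)
    then show ?case by (auto simp: comprel_def)
  next
    case (step y z)
    then obtain m where m: "m \<in> V" "m = x \<or> ll F m x" "m = y \<or> ll F m y" by blast
    from step(2) have z: "z \<in> V" "ll F y z \<or> ll F z y" by (auto simp: comprel_def)
    then show ?case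
    proof (elim disjE)
      assume "ll F y z"
      then have "ll F m z" using m(3) by (auto simp: ll_iff_plt intro: plt_trans)
      with m show ?thesis by blast
    next
      assume zy: "ll F z y"
      then have "m = z \<or> ll F m z \<or> ll F z m"
        using m(3) plt_linear_below[of m y z] by (auto simp: ll_iff_plt)
      moreover have "ll F z x" if "ll F z m"
        using m(2) that by (auto simp: ll_iff_plt intro: plt_trans)
      ultimately show ?thesis using m z by blast
    qed
  qed
  then show ?thesis using assms by (auto simp: linked_def)
qed

text \<open>Components of an upward closed set are upward closed, hence convex. Two roots of
  \<open>C\<close> have a common lower bound \<open>m\<close> in \<open>C\<close>. Each of them is
  \<open>m\<close> or a left sibling of \<open>m\<close>, since otherwise its parent would lie
  weakly above \<open>m\<close> and so belong to \<open>C\<close>.\<close>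

lemma arb_words_restr_comp:
  assumes V: "V \<subseteq> verts F" and up: "\<And>x y. x \<in> V \<Longrightarrow> ll F x y \<Longrightarrow> y \<in> V"
    and C: "C \<in> comps F V"
  shows "arb_words (restr F C) = wext C (ll F) (dec F)"
proof (rule arb_words_restr)
  have CV: "C \<subseteq> V" using C Union_comps by blast
  then show "C \<subseteq> verts F" using V by blast
  have above: "y \<in> C" if "x \<in> C" "ll F x y" for x y
    using that comps_linked_iff[OF C that(1)] linked_if_comparable[of x V y F] up CV by blast
  then show "\<And>x y z. x \<in> C \<Longrightarrow> z \<in> C \<Longrightarrow> ll F x y \<Longrightarrow> ll F y z \<Longrightarrow> y \<in> C" by blast
  have root: "butlast x = butlast m" if m: "m \<in> C" "m = x \<or> ll F m x" "butlast x \<notin> C" for m x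
  proof (cases "m = x")
    case False
    then have mx: "plt m x" "m \<in> verts F" "x \<in> verts F" using m by (auto simp: ll_iff_plt)
    from mx(1) obtain p i j u where e: "m = p @ [i]" "x = p @ [j] @ u" "j \<le> i" "j < i \<or> u \<noteq> []"
      by (rule pltE)
    show ?thesis
    proof (cases u rule: rev_cases)
      case (snoc u' k)
      then have b: "butlast x = p @ j # u'" using e by (simp add: butlast_append)
      then have "butlast x \<in> verts F"
        using verts_prefix[of "butlast x" "[k]" F] mx e snoc by simp
      moreover have "plt m (butlast x) \<or> m = butlast x"
        using b e plt_append_iff[of p i j u'] by auto
      ultimately have "butlast x \<in> C" using above m(1) mx by (auto simp: ll_iff_plt)
      with m show ?thesis by blast
    qed (use e in simp)
  qed simp
  show "butlast x = butlast y" if "x \<in> C" "y \<in> C" "butlast x \<notin> C" "butlast y \<notin> C" for x y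
  proof -
    have "linked F V x y" using comps_linked_iff[OF C that(1)] that(2) by blast
    from linked_lower_bound[OF this] obtain m
      where m: "m \<in> V" "m = x \<or> ll F m x" "m = y \<or> ll F m y" by blast
    have "m \<in> C"
      using comps_linked_iff[OF C that(1)] linked_if_comparable[of x V m F] m that(1) CV by blast
    then show ?thesis using root[of m x] root[of m y] m that by simp
  qed
qed

lemma arb_ll_comp_prod:
  assumes V: "V \<subseteq> verts F" and up: "\<And>x y. x \<in> V \<Longrightarrow> ll F x y \<Longrightarrow> y \<in> V"
  shows "arb_ll (comp_prod F V) = msv (wext V (ll F) (dec F))"
proof -
  let ?cs = "SOME cs. distinct cs \<and> set cs = comps F V"
  have "finite V" using V finite_verts by (rule finite_subset)
  then have "finite (comps F V)" by (simp add: comps_eq_linked)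
  then have "\<exists>cs. distinct cs \<and> set cs = comps F V" using finite_distinct_list by blast
  then have cs: "distinct ?cs \<and> set ?cs = comps F V" by (rule someI_ex)
  \<comment> \<open>Stated for all distinct lists of components, so that it covers whichever list
    \<open>SOME\<close> picks.\<close>
  have "arb_ll (foldr shmult (map (\<lambda>C. vsingle (restr F C)) cs) unitv) =
      msv (wext (\<Union>(set cs)) (ll F) (dec F))"
    if "distinct cs" "set cs \<subseteq> comps F V" for cs
    using that
  proof (induction cs)
    case Nil
    then show ?case by (simp add: unitv_def)
  next
    case (Cons C cs)
    have C: "C \<in> comps F V" using Cons.prems by simp
    \<comment> \<open>Vertices of different components are incomparable, which is what
      \<open>wext_Un\<close> asks for.\<close>
    have other: "C = C'" if "C' \<in> comps F V" "x \<in> C" "y \<in> C'" "x = y \<or> ll F x y \<or> ll F y x" for C' x y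
    proof -
      have "x \<in> V" "y \<in> V" using that C Union_comps by blast+
      then have "linked F V x y"
        using that(4) linked_if_comparable[of x V y F] by (auto simp: linked_def)
      then have "y \<in> C" using comps_linked_iff[OF C that(2)] by blast
      then show ?thesis using comps_linked_iff[OF C] comps_linked_iff[OF that(1,3)] by blast
    qed
    have "wext (C \<union> \<Union>(set cs)) (ll F) (dec F) =
        msh (wext C (ll F) (dec F)) (wext (\<Union>(set cs)) (ll F) (dec F))"
      by (rule wext_Un) (use other Cons.prems in \<open>fastforce simp: ll_iff_plt\<close>)+
    then show ?case
      using Cons arb_words_restr_comp[OF V up C] by (simp add: arb_ll_shmult shmult_msv)
  qed
  from this[of ?cs] cs show ?thesis by (simp add: comp_prod_def Union_comps)
qed

section \<open>Compatibility with the coproducts\<close>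

lemma downclosed_iff:
  "downclosed F W \<longleftrightarrow> W \<subseteq> verts F \<and> (\<forall>x\<in>verts F - W. \<forall>y\<in>W. \<not> ll F x y)"
  unfolding downclosed_def by (auto simp: ll_iff_plt)

text \<open>A parent lies below its child, so \<open>W\<close> contains the parents of its vertices.
  The roots of the induced forest are thus roots of \<open>F\<close>, all with the empty path as
  parent.\<close>

lemma arb_words_restr_downclosed:
  assumes "downclosed F W"
  shows "arb_words (restr F W) = wext W (ll F) (dec F)"
proof (rule arb_words_restr)
  show WF: "W \<subseteq> verts F" using assms by (simp add: downclosed_def)
  show "\<And>x y z. x \<in> W \<Longrightarrow> z \<in> W \<Longrightarrow> ll F x y \<Longrightarrow> ll F y z \<Longrightarrow> y \<in> W"
    using assms by (auto simp: downclosed_def)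
  have "butlast x = []" if "x \<in> W" "butlast x \<notin> W" for x
  proof (rule ccontr)
    assume b: "butlast x \<noteq> []"
    then have x: "x = butlast x @ [last x]" "x \<in> verts F" using that WF by (cases x; auto)+
    then have "butlast x \<in> verts F" using verts_prefix[of "butlast x" "[last x]" F] b by simp
    moreover have "plt (butlast x) x" using plt_child[OF b, of "[last x]"] x by simp
    ultimately have "ll F (butlast x) x" using x by (simp add: ll_iff_plt)
    then show False using assms that by (auto simp: downclosed_def)
  qed
  then show "\<And>x y. x \<in> W \<Longrightarrow> y \<in> W \<Longrightarrow> butlast x \<notin> W \<Longrightarrow> butlast y \<notin> W \<Longrightarrow> butlast x = butlast y"
    by metis
qed

lemma cop_sh_arb_ll:
  fixes u :: "'a pforest \<Rightarrow>\<^sub>0 'k::field"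
  shows "cop_sh (arb_ll u) = tmap arb_ll (cop_mkw u)"
proof (induction u rule: vector_induct)
  case (vsingle F)
  have "tmap arb_ll (tensor (comp_prod F (verts F - W)) (vsingle (restr F W)) :: _ \<Rightarrow>\<^sub>0 'k) =
      tensor (msv (wext (verts F - W) (ll F) (dec F))) (msv (wext W (ll F) (dec F)))"
    if "downclosed F W" for W
  proof -
    \<comment> \<open>The complement of a downward closed set is upward closed.\<close>
    have "arb_ll (comp_prod F (verts F - W) :: _ \<Rightarrow>\<^sub>0 'k) = msv (wext (verts F - W) (ll F) (dec F))"
      by (rule arb_ll_comp_prod) (use that in \<open>auto simp: downclosed_def ll_iff_plt\<close>)
    then show ?thesis
      by (simp add: tmap_tensor arb_ll_add arb_ll_smult arb_words_restr_downclosed[OF that])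
  qed
  then have "tmap arb_ll (mkw_delta F :: _ \<Rightarrow>\<^sub>0 'k) = (\<Sum>W\<in>{W. downclosed F W}.
      tensor (msv (wext (verts F - W) (ll F) (dec F))) (msv (wext W (ll F) (dec F))))"
    by (simp add: mkw_delta_def tmap_def lin_sum)
  then show ?case
    by (simp add: cop_sh_def cop_mkw_def arb_words_def downclosed_iff deconc_wext ll_iff_plt)
qed (simp_all add: cop_sh_def cop_mkw_def tmap_def arb_ll_add arb_ll_smult lin_add lin_smult)

lemma hopf_morphism_arb_ll: "hopf_morphism arb_ll cop_mkw cop_sh"
  by (simp add: hopf_morphism_def arb_ll_add arb_ll_smult arb_ll_shmult counit_arb_ll
      cop_sh_arb_ll unitv_def)

lemma combinatorial_morphism_arb_ll:
  "combinatorial_morphism (arb_ll :: ('a pforest \<Rightarrow>\<^sub>0 'k::field) \<Rightarrow> _)"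
proof -
  \<comment> \<open>Only an inclusion of supports: in positive characteristic a multiplicity may
    vanish in the field.\<close>
  have "w \<in># arb_words F" if "w \<in> Poly_Mapping.keys (msv (arb_words F) :: _ \<Rightarrow>\<^sub>0 'k)"
    for w and F :: "'a pforest"
    using that by (intro count_inI) (simp add: in_keys_iff)
  then show ?thesis
    by (auto simp: combinatorial_morphism_def hopf_morphism_arb_ll length_arb_words)
qed

section \<open>Symmetrization\<close>

text \<open>By acyclicity a child has strictly fewer proper descendants than its parent, so their
  number bounds the depth still to be built, and all larger fuels agree.\<close>

lemma build_eq_if_card_below:
  assumes nf: "nforest V par" and ps: "planar_structure V par ord"
  shows "v \<in> V \<Longrightarrow> card {w. (w, v) \<in> (child_rel V par)\<^sup>+} \<le> n \<Longrightarrow>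
    card {w. (w, v) \<in> (child_rel V par)\<^sup>+} \<le> m \<Longrightarrow> build ord phi n v = build ord phi m v"
proof (induction n arbitrary: v m)
  let ?r = "child_rel V par" and ?D = "\<lambda>v. {w. (w, v) \<in> (child_rel V par)\<^sup>+}"
  have "finite V" using nf by (simp add: nforest_def)
  have "(?r)\<^sup>+ \<subseteq> V \<times> V" using nf by (intro trancl_subset_Sigma) (auto simp: child_rel_def nforest_def)
  then have fin: "finite (?D v)" for v
    by (intro finite_subset[OF _ \<open>finite V\<close>]) auto
  have ch: "set (ord (Some v)) = {w \<in> V. par w = Some v}" if "v \<in> V" for v
    using ps that by (simp add: planar_structure_def)
  have leaf: "ord (Some v) = []" if "v \<in> V" "card (?D v) \<le> 0" for v
  proof -
    have "?D v = {}" using that fin by simp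
    then have "set (ord (Some v)) = {}"
      unfolding ch[OF that(1)] by (auto simp: child_rel_def)
    then show ?thesis by simp
  qed
  {
    case 0
    then show ?case using leaf[of v] by (cases m) auto
  next
    case (Suc n)
    show ?case
    proof (cases m)
      case 0
      then show ?thesis using leaf[of v] Suc.prems by simp
    next
      case (Suc m')
      have "build ord phi n w = build ord phi m' w" if w: "w \<in> set (ord (Some v))" for w
      proof -
        have wv: "(w, v) \<in> ?r" "w \<in> V" using w ch Suc.prems(1) by (auto simp: child_rel_def)
        then have "w \<in> ?D v" "?D w \<subseteq> ?D v" by (auto intro: trancl_into_trancl)
        moreover have "w \<notin> ?D w" using nf by (simp add: nforest_def acyclic_def)
        ultimately have "?D w \<subset> ?D v" by blast
        then have "card (?D w) < card (?D v)" using fin by (intro psubset_card_mono)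
        then show ?thesis using Suc.prems Suc wv(2) by (intro Suc.IH) auto
      qed
      then show ?thesis using Suc by simp
    qed
  }
qed

lemma arb_words_planar_of:
  assumes nf: "nforest V par" and ps: "planar_structure V par ord"
  shows "arb_words (planar_of V ord phi) = wext V (ordgen V par ord) phi"
proof -
  interpret planar_unfolding V par ord phi "build ord phi (card V)"
  proof unfold_locales
    fix v assume v: "v \<in> V"
    have "finite V" using nf by (simp add: nforest_def)
    moreover have "(child_rel V par)\<^sup>+ \<subseteq> V \<times> V"
      using nf by (intro trancl_subset_Sigma) (auto simp: child_rel_def nforest_def)
    ultimately have "card {w. (w, v) \<in> (child_rel V par)\<^sup>+} \<le> card V"
      by (intro card_mono) auto
    \<comment> \<open>One extra unit of fuel exposes the recursion without changing the
      tree.\<close>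
    then have "build ord phi (card V) v = build ord phi (Suc (card V)) v"
      by (intro build_eq_if_card_below[OF nf ps v]) auto
    then show "build ord phi (card V) v = Node (phi v) (map (build ord phi (card V)) (ord (Some v)))"
      by simp
  qed (rule nf ps)+
  show ?thesis using arb_words_forest by (simp add: planar_of_def forest_def)
qed

text \<open>The normalization to \<open>[]\<close> leaves a choice at finitely many arguments only,
  each among the distinct lists over \<open>V\<close>.\<close>

lemma finite_planar_structures:
  assumes "finite V"
  shows "finite {ord. planar_structure V par ord}"
proof (rule finite_subset)
  let ?A = "insert None (Some ` V)" and ?B = "{xs. set xs \<subseteq> V \<and> distinct xs}"
  show "{ord. planar_structure V par ord} \<subseteq> {f. \<forall>x. (x \<in> ?A \<longrightarrow> f x \<in> ?B) \<and> (x \<notin> ?A \<longrightarrow> f x = [])}"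
    unfolding planar_structure_def by (force simp: image_iff)
  show "finite {f. \<forall>x. (x \<in> ?A \<longrightarrow> f x \<in> ?B) \<and> (x \<notin> ?A \<longrightarrow> f x = [])}"
    using assms by (intro finite_set_of_finite_funs finite_subset_distinct) auto
qed

section \<open>Planar structures read off from linear extensions\<close>

lemma sorted_wrt_asym_unique:
  assumes "\<And>x y. P x y \<Longrightarrow> \<not> P y x"
  shows "sorted_wrt P xs \<Longrightarrow> sorted_wrt P ys \<Longrightarrow> set xs = set ys \<Longrightarrow> xs = ys"
proof (induction xs ys rule: list_induct2')
  case (4 x xs y ys)
  have "x = y" using 4 assms by (metis insert_iff list.simps(15) sorted_wrt.simps(2))
  have "\<forall>a\<in>set xs. P x a" "\<forall>a\<in>set ys. P y a" using 4 by simp_all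
  then have "x \<notin> set xs" "y \<notin> set ys" using assms by blast+
  with \<open>x = y\<close> have "set xs = set ys" using 4(4) by (simp add: insert_ident)
  with \<open>x = y\<close> show ?case using 4(1-3) by simp
qed auto

definition before :: "'v list \<Rightarrow> 'v \<Rightarrow> 'v \<Rightarrow> bool" where
  "before vs x y \<longleftrightarrow> (\<exists>i j. i < j \<and> j < length vs \<and> vs ! i = x \<and> vs ! j = y)"

lemma sorted_wrt_before: "sorted_wrt (before vs) vs"
  by (auto simp: sorted_wrt_iff_nth_less before_def)

lemma before_nth:
  assumes "distinct vs" "i < length vs" "j < length vs"
  shows "before vs (vs ! i) (vs ! j) \<longleftrightarrow> i < j"
  using assms by (auto simp: before_def nth_eq_iff_index_eq)

lemma before_asym: "distinct vs \<Longrightarrow> before vs x y \<Longrightarrow> \<not> before vs y x"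
  by (auto simp: before_def nth_eq_iff_index_eq)

text \<open>Uniqueness of the planar structure: a later sibling is lower, hence occurs later in
  \<open>vs\<close>. So \<open>ord x\<close> and the filtered \<open>vs\<close> have the same
  elements and are sorted by the same asymmetric relation.\<close>

lemma lext_ordgen_imp_filter:
  assumes ps: "planar_structure V par ord" and vs: "vs \<in> lext V (ordgen V par ord)"
    and x: "x = None \<or> (\<exists>u\<in>V. x = Some u)"
  shows "ord x = filter (\<lambda>v. par v = x) vs"
proof (rule sorted_wrt_asym_unique)
  have ox: "set (ord x) = {v \<in> V. par v = x}" 
    using ps[unfolded planar_structure_def, THEN conjunct1, THEN spec, THEN mp, OF x] by simp
  show "\<And>a b. before vs a b \<Longrightarrow> \<not> before vs b a" 
    by (rule before_asym[OF distinct_lext[OF vs]])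
  show "sorted_wrt (before vs) (filter (\<lambda>v. par v = x) vs)"
    by (intro sorted_wrt_filter sorted_wrt_before)
  show "set (ord x) = set (filter (\<lambda>v. par v = x) vs)" using ox vs by (auto simp: lext_def)
  show "sorted_wrt (before vs) (ord x)"
    unfolding sorted_wrt_iff_nth_less
  proof (intro allI impI)
    fix l k assume lk: "l < k" "k < length (ord x)"
    then have "ord x ! l \<in> V" "ord x ! k \<in> V" using ox nth_mem[of l "ord x"] nth_mem[of k "ord x"] by auto
    then have g: "ordgen V par ord (ord x ! k) (ord x ! l)" using lk by (auto simp: ordgen_def)
    have "ord x ! l \<in> set vs" "ord x ! k \<in> set vs"
      using \<open>ord x ! l \<in> V\<close> \<open>ord x ! k \<in> V\<close> vs by (simp_all add: lext_def)
    then obtain i j where ij: "i < length vs" "vs ! i = ord x ! l" "j < length vs" "vs ! j = ord x ! k"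
      by (auto simp: in_set_conv_nth)
    with g have "ordgen V par ord (vs ! j) (vs ! i)" by simp
    then have "i < j" using vs ij(1,3) by (simp add: lext_def)
    then show "before vs (ord x ! l) (ord x ! k)"
      unfolding before_def using ij by blast
  qed
qed

lemma lext_ordgen_subset:
  assumes nf: "nforest V par"
  shows "lext V (ordgen V par ord) \<subseteq> lext V (\<lambda>x y. (y, x) \<in> (child_rel V par)\<^sup>+)"
proof (rule lext_mono_tranclp)
  fix x y assume "(y, x) \<in> (child_rel V par)\<^sup>+"
  then show "(ordgen V par ord)\<^sup>+\<^sup>+ x y"
  proof (induction rule: trancl_induct)
    case (base x)
    then show ?case using nf by (auto simp: child_rel_def ordgen_def nforest_def)
  next
    case (step a b)
    then have "ordgen V par ord b a" using nf by (auto simp: child_rel_def ordgen_def nforest_def)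
    then show ?case using step.IH by (rule tranclp_into_tranclp2)
  qed
qed (simp add: ordgen_def)

text \<open>Existence: siblings are listed as they occur in \<open>vs\<close>, which settles the
  sibling generators; the parent generators hold because \<open>vs\<close> extends the forest
  order.\<close>

lemma lext_child_rel_imp_ordgen:
  assumes vs: "vs \<in> lext V (\<lambda>x y. (y, x) \<in> (child_rel V par)\<^sup>+)"
  shows "\<exists>ord. planar_structure V par ord \<and> vs \<in> lext V (ordgen V par ord)"
proof -
  define ord where
    "ord x = (if x \<in> insert None (Some ` V) then filter (\<lambda>v. par v = x) vs else [])" for x
  have d: "distinct vs" "set vs = V" using vs by (simp_all add: lext_def)
  have "planar_structure V par ord"
    using d by (auto simp: planar_structure_def ord_def)
  moreover have "j < i"
    if ij: "i < length vs" "j < length vs" "ordgen V par ord (vs ! i) (vs ! j)" for i j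
  proof (cases "par (vs ! j) = Some (vs ! i)")
    case True
    then have "(vs ! j, vs ! i) \<in> (child_rel V par)\<^sup>+"
      using ij(3) by (intro r_into_trancl) (auto simp: child_rel_def ordgen_def)
    then show ?thesis using vs ij by (auto simp: lext_def)
  next
    case False
    then obtain z k l where "k < length (ord z)" "l < k" "vs ! i = ord z ! k" "vs ! j = ord z ! l"
      using ij(3) by (auto simp: ordgen_def)
    moreover have "sorted_wrt (before vs) (ord z)"
      by (simp add: ord_def sorted_wrt_filter sorted_wrt_before)
    ultimately have "before vs (vs ! j) (vs ! i)" by (simp add: sorted_wrt_iff_nth_less)
    then show ?thesis using before_nth[OF d(1)] ij by blast
  qed
  ultimately show ?thesis using d by (intro exI[of _ ord]) (simp add: lext_def)
qed

lemma sum_const_eq_smult: "finite A \<Longrightarrow> (\<Sum>x\<in>A. u) = smult (of_nat (card A)) u"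
  by (induction A rule: finite_induct) (simp_all add: smult_add add.commute)

lemma arb_ll_Omega:
  fixes V :: "'v set" and phi :: "'v \<Rightarrow> 'a"
  assumes nf: "nforest V par"
  shows "arb_ll (Omega V par phi) = (simple_arb V par phi :: 'a list \<Rightarrow>\<^sub>0 'k::field)"
proof -
  let ?PS = "{ord. planar_structure V par ord}" and ?p = "\<lambda>ord. planar_of V ord phi"
  let ?R = "\<lambda>x y. (y, x) \<in> (child_rel V par)\<^sup>+"
  have fin: "finite ?PS" using nf by (intro finite_planar_structures) (simp add: nforest_def)
  have "arb_ll (Omega V par phi) =
      (\<Sum>\<sigma>\<in>?p ` ?PS. smult (of_nat (Sym V par phi \<sigma>)) (msv (arb_words \<sigma>)) :: 'a list \<Rightarrow>\<^sub>0 'k)"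
    by (simp add: Omega_def arb_ll_def lin_sum lin_smult arb_ll_basis_eq setcompr_eq_image)
  \<comment> \<open>\<open>Sym\<close> counts the fibres of \<open>planar_of\<close>, so the
    weighted sum over forests is a plain sum over planar structures.\<close>
  also have "\<dots> = (\<Sum>\<sigma>\<in>?p ` ?PS. \<Sum>ord\<in>{ord \<in> ?PS. ?p ord = \<sigma>}. msv (arb_words (?p ord)))"
  proof (rule sum.cong[OF refl])
    fix \<sigma>
    have "(\<Sum>ord\<in>{ord \<in> ?PS. ?p ord = \<sigma>}. msv (arb_words (?p ord))) =
        (\<Sum>ord\<in>{ord \<in> ?PS. ?p ord = \<sigma>}. msv (arb_words \<sigma>) :: 'a list \<Rightarrow>\<^sub>0 'k)"
      by (rule sum.cong) auto
    also have "\<dots> = smult (of_nat (Sym V par phi \<sigma>)) (msv (arb_words \<sigma>))"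
      using fin by (subst sum_const_eq_smult) (simp_all add: Sym_def)
    finally show "smult (of_nat (Sym V par phi \<sigma>)) (msv (arb_words \<sigma>) :: 'a list \<Rightarrow>\<^sub>0 'k) =
        (\<Sum>ord\<in>{ord \<in> ?PS. ?p ord = \<sigma>}. msv (arb_words (?p ord)))" by simp
  qed
  also have "\<dots> = (\<Sum>ord\<in>?PS. msv (arb_words (?p ord)))"
    by (rule sum.image_gen[OF fin, symmetric])
  also have "\<dots> = (\<Sum>ord\<in>?PS. \<Sum>vs\<in>lext V (ordgen V par ord). vsingle (map phi vs))"
    by (simp add: arb_words_planar_of[OF nf] wext_def msv_mset_set)
  \<comment> \<open>An extension determines its planar structure, so the sets of extensions are
    disjoint.\<close>
  also have "\<dots> = (\<Sum>vs\<in>(\<Union>ord\<in>?PS. lext V (ordgen V par ord)). vsingle (map phi vs))"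
  proof (rule sum.UNION_disjoint[OF fin, symmetric])
    have "ord = ord'"
      if "planar_structure V par ord" "planar_structure V par ord'"
        "vs \<in> lext V (ordgen V par ord)" "vs \<in> lext V (ordgen V par ord')" for ord ord' vs
    proof
      fix x
      show "ord x = ord' x"
      proof (cases "x = None \<or> (\<exists>u\<in>V. x = Some u)")
        case True
        show ?thesis
          using lext_ordgen_imp_filter[OF that(1,3) True] lext_ordgen_imp_filter[OF that(2,4) True]
          by simp
      next
        case False
        note outside = planar_structure_def[THEN iffD1, THEN conjunct2, THEN spec, THEN mp, OF _ False]
        show ?thesis using outside[OF that(1)] outside[OF that(2)] by simp
      qed
    qed
    then show "\<forall>i\<in>?PS. \<forall>j\<in>?PS. i \<noteq> j \<longrightarrow>
        lext V (ordgen V par i) \<inter> lext V (ordgen V par j) = {}"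
      by (metis disjoint_iff mem_Collect_eq)
  qed simp
  also have "(\<Union>ord\<in>?PS. lext V (ordgen V par ord)) = lext V ?R"
  proof (intro equalityI subsetI)
    fix vs assume "vs \<in> lext V ?R"
    from lext_child_rel_imp_ordgen[OF this]
    show "vs \<in> (\<Union>ord\<in>?PS. lext V (ordgen V par ord))" by blast
  next
    fix vs assume "vs \<in> (\<Union>ord\<in>?PS. lext V (ordgen V par ord))"
    then obtain ord where "vs \<in> lext V (ordgen V par ord)" by blast
    then show "vs \<in> lext V ?R" using lext_ordgen_subset[OF nf] by (rule rev_subsetD)
  qed
  finally show ?thesis by (simp add: simple_arb_def lext_def)
qed

theorem mainTheorem11:
  shows "hopf_morphism (arb_ll :: ('a pforest \<Rightarrow>\<^sub>0 'k::field) \<Rightarrow> ('a list \<Rightarrow>\<^sub>0 'k)) cop_mkw cop_sh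
    \<and> surj (arb_ll :: ('a pforest \<Rightarrow>\<^sub>0 'k) \<Rightarrow> ('a list \<Rightarrow>\<^sub>0 'k))
    \<and> (finite (UNIV :: 'a set) \<longrightarrow>
         combinatorial_morphism (arb_ll :: ('a pforest \<Rightarrow>\<^sub>0 'k) \<Rightarrow> ('a list \<Rightarrow>\<^sub>0 'k)))
    \<and> (\<forall>(V :: 'v set) par (phi :: 'v \<Rightarrow> 'a). nforest V par \<longrightarrow>
         arb_ll (Omega V par phi :: 'a pforest \<Rightarrow>\<^sub>0 'k) = simple_arb V par phi)"
  by (simp add: hopf_morphism_arb_ll surj_arb_ll combinatorial_morphism_arb_ll arb_ll_Omega)

end
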